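(* Let $n\ge 3$. Consider all complete $n$-dimensional warped products $M=\mathbb{R}\times_{h'}M_*$, with metric $g=dt^2+(h'(t))^2g_*$ and a potential function $f=f(t)$, that are steady gradient Ricci-Bourguignon solitons in the sense that $$\mathrm{Ric}+\nabla^2 f-\frac{S}{n}\,g=0,$$ and for which $\lambda_*=0$, where $\lambda_*$ is the normalized Einstein constant of $(M_*,g_* )$ (for $n=3$ it is assumed that $g_*$ is a metric of constant curvature $\lambda_*$). They can be classified as follows: $(M_*,g_* )$ must be complete and Ricci flat, and the possible non-constant functions $h'>0$ and $f'$ are the following: $$h'(t)=\Big(\Big[\frac{B}{D}+E^{n-1}\Big]e^{(n-1)Dt}-\frac{B}{D}\Big)^{1/(n-1)}\quad\text{and}\quad f'=C\,(h')^{1-n}$$ with constants $B>0$, $C>0$, $D<0$, $E=h'(0)$ such that $E^{n-1}>-\frac{B}{D}$.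
   Context: $\mathbb{R}\times_{h'}M_*$ denotes $\mathbb{R}\times M_*$ with the warped product metric $g=dt^2+(h'(t))^2g_*$, where $(M_*,g_* )$ is an $(n-1)$-dimensional Riemannian manifold; the warping function is $h'$, the derivative of a function $h$, and primes denote derivatives with respect to $t$. The functions $h$ and $f$ are smooth, and $h'$ is not constant and non-zero (isolated zeros of $h'$ being allowed only if the metric singularity is removable, as for polar coordinates). $\mathrm{Ric}$, $S$ and $\nabla^2 f$ are the Ricci tensor, the scalar curvature and the Hessian of $f$ with respect to $g$. For such solitons $(M_*,g_* )$ is Einstein, $\mathrm{Ric}_*=\lambda_*g_*$ with a constant $\lambda_*$, where $\mathrm{Ric}_*$ is the Ricci tensor of $g_*$. A gradient Ricci-Bourguignon soliton is a metric $g$ with a smooth function $f$ such that $\mathrm{Ric}+\nabla^2 f-\rho Sg=\lambda g$ with constants $\rho,\lambda$; it is steady if $\lambda=0$. Here $\rho=1/n$.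
   Formalization: The classification holds up to the reflection t → -t (which flips the signs of B, C, D), and the constants B and C are tied by B = nC/((n-1)(n-2)); without these two corrections the displayed list is not exactly the set of solitons. *)

theory Defs
  imports "HOL-Analysis.Analysis"
begin

section \<open>Smooth maps on open subsets of Euclidean spaces\<close>

primrec Ck_on :: "nat \<Rightarrow> 'a::real_normed_vector set \<Rightarrow> ('a \<Rightarrow> 'b::real_normed_vector) \<Rightarrow> bool" where
  "Ck_on 0 S F \<longleftrightarrow> continuous_on S F"
| "Ck_on (Suc k) S F \<longleftrightarrow>
     (\<forall>x\<in>S. F differentiable at x) \<and> (\<forall>v. Ck_on k S (\<lambda>x. frechet_derivative F (at x) v))"

text \<open>Only used for open \<open>S\<close> in finite-dimensional spaces.\<close>
definition smooth_on :: "'a::real_normed_vector set \<Rightarrow> ('a \<Rightarrow> 'b::real_normed_vector) \<Rightarrow> bool" where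
  "smooth_on S F \<longleftrightarrow> (\<forall>k. Ck_on k S F)"

section \<open>Riemannian manifolds\<close>

text \<open>
  A Riemannian manifold with underlying space \<open>'p\<close> (the whole type) modelled on the Euclidean
  space \<open>'e\<close> is given by a smooth atlas in which every chart carries the local expression of the
  metric: for a point \<open>x\<close> of the image of the chart, \<open>chart_metric c x v w\<close> is the value of the
  metric on the tangent vectors whose coordinate vectors are \<open>v\<close> and \<open>w\<close>.  The local
  expressions are related by the usual transformation law.  Connectedness is not demanded.
\<close>

datatype ('p, 'e) rchart =
  RChart (chart_dom: "'p set") (chart_map: "'p \<Rightarrow> 'e") (chart_metric: "'e \<Rightarrow> 'e \<Rightarrow> 'e \<Rightarrow> real")

definition chart_image :: "('p, 'e) rchart \<Rightarrow> 'e set" where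
  "chart_image c = chart_map c ` chart_dom c"

definition chart_inv :: "('p, 'e) rchart \<Rightarrow> 'e \<Rightarrow> 'p" where
  "chart_inv c = inv_into (chart_dom c) (chart_map c)"

definition local_riemannian :: "('p::topological_space, 'e::euclidean_space) rchart \<Rightarrow> bool" where
  "local_riemannian c \<longleftrightarrow>
     open (chart_dom c) \<and> open (chart_image c) \<and>
     homeomorphism (chart_dom c) (chart_image c) (chart_map c) (chart_inv c) \<and>
     (\<forall>v w. smooth_on (chart_image c) (\<lambda>x. chart_metric c x v w)) \<and>
     (\<forall>x\<in>chart_image c.
        bilinear (chart_metric c x) \<and>
        (\<forall>v w. chart_metric c x v w = chart_metric c x w v) \<and>
        (\<forall>v. v \<noteq> 0 \<longrightarrow> chart_metric c x v v > 0))"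

definition transition :: "('p, 'e) rchart \<Rightarrow> ('p, 'e) rchart \<Rightarrow> 'e \<Rightarrow> 'e" where
  "transition c d = chart_map d \<circ> chart_inv c"

definition compatible_charts ::
    "('p::topological_space, 'e::euclidean_space) rchart \<Rightarrow> ('p, 'e) rchart \<Rightarrow> bool" where
  "compatible_charts c d \<longleftrightarrow>
     smooth_on (chart_map c ` (chart_dom c \<inter> chart_dom d)) (transition c d) \<and>
     (\<forall>p\<in>chart_dom c \<inter> chart_dom d. \<forall>v w.
        chart_metric c (chart_map c p) v w =
        chart_metric d (chart_map d p)
          (frechet_derivative (transition c d) (at (chart_map c p)) v)
          (frechet_derivative (transition c d) (at (chart_map c p)) w))"

definition riemannian_manifold ::
    "('p::{t2_space, second_countable_topology}, 'e::euclidean_space) rchart set \<Rightarrow> bool" where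
  "riemannian_manifold A \<longleftrightarrow>
     (\<Union>c\<in>A. chart_dom c) = UNIV \<and>
     (\<forall>c\<in>A. local_riemannian c) \<and>
     (\<forall>c\<in>A. \<forall>d\<in>A. compatible_charts c d)"

section \<open>Levi-Civita connection and curvature in coordinates\<close>

text \<open>In this section \<open>G\<close> is the local expression of a metric and \<open>x\<close> a point in coordinates.\<close>

text \<open>The vector dual to a linear form with respect to an inner product.\<close>
definition sharp :: "('e \<Rightarrow> 'e \<Rightarrow> real) \<Rightarrow> ('e \<Rightarrow> real) \<Rightarrow> 'e" where
  "sharp b \<alpha> = (THE z. \<forall>w. b z w = \<alpha> w)"

text \<open>\<open>christoffel G x v w\<close> is the vector with components
  \<open>\<Gamma>\<^sup>k\<^sub>i\<^sub>j v\<^sup>i w\<^sup>j\<close>.\<close>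
definition christoffel ::
    "('e::euclidean_space \<Rightarrow> 'e \<Rightarrow> 'e \<Rightarrow> real) \<Rightarrow> 'e \<Rightarrow> 'e \<Rightarrow> 'e \<Rightarrow> 'e" where
  "christoffel G x v w = sharp (G x) (\<lambda>z.
     (frechet_derivative (\<lambda>y. G y w z) (at x) v
      + frechet_derivative (\<lambda>y. G y v z) (at x) w
      - frechet_derivative (\<lambda>y. G y v w) (at x) z) / 2)"

text \<open>\<open>R(u,v)w = \<nabla>\<^sub>u\<nabla>\<^sub>v w - \<nabla>\<^sub>v\<nabla>\<^sub>u w - \<nabla>\<^bsub>[u,v]\<^esub> w\<close> for coordinate-constant vector fields.\<close>
definition riemann_curv ::
    "('e::euclidean_space \<Rightarrow> 'e \<Rightarrow> 'e \<Rightarrow> real) \<Rightarrow> 'e \<Rightarrow> 'e \<Rightarrow> 'e \<Rightarrow> 'e \<Rightarrow> 'e" where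
  "riemann_curv G x u v w =
     frechet_derivative (\<lambda>y. christoffel G y v w) (at x) u
     - frechet_derivative (\<lambda>y. christoffel G y u w) (at x) v
     + christoffel G x u (christoffel G x v w)
     - christoffel G x v (christoffel G x u w)"

definition ricci :: "('e::euclidean_space \<Rightarrow> 'e \<Rightarrow> 'e \<Rightarrow> real) \<Rightarrow> 'e \<Rightarrow> 'e \<Rightarrow> 'e \<Rightarrow> real" where
  "ricci G x v w = (\<Sum>b\<in>Basis. riemann_curv G x b v w \<bullet> b)"

definition scalar_curv :: "('e::euclidean_space \<Rightarrow> 'e \<Rightarrow> 'e \<Rightarrow> real) \<Rightarrow> 'e \<Rightarrow> real" where
  "scalar_curv G x = (\<Sum>b\<in>Basis. sharp (G x) (ricci G x b) \<bullet> b)"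

definition hessian ::
    "('e::euclidean_space \<Rightarrow> 'e \<Rightarrow> 'e \<Rightarrow> real) \<Rightarrow> ('e \<Rightarrow> real) \<Rightarrow> 'e \<Rightarrow> 'e \<Rightarrow> 'e \<Rightarrow> real" where
  "hessian G F x v w =
     frechet_derivative (\<lambda>y. frechet_derivative F (at y) w) (at x) v
     - frechet_derivative F (at x) (christoffel G x v w)"

section \<open>Curvature conditions and solitons\<close>

definition gradient_RB_soliton ::
    "('p, 'e::euclidean_space) rchart set \<Rightarrow> ('p \<Rightarrow> real) \<Rightarrow> real \<Rightarrow> real \<Rightarrow> bool" where
  "gradient_RB_soliton A F \<rho> \<mu> \<longleftrightarrow>
     (\<forall>c\<in>A. \<forall>x\<in>chart_image c. \<forall>v w.
        ricci (chart_metric c) x v w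
        + hessian (chart_metric c) (F \<circ> chart_inv c) x v w
        - \<rho> * scalar_curv (chart_metric c) x * chart_metric c x v w
        = \<mu> * chart_metric c x v w)"

definition steady_RB_soliton ::
    "('p, 'e::euclidean_space) rchart set \<Rightarrow> ('p \<Rightarrow> real) \<Rightarrow> real \<Rightarrow> bool" where
  "steady_RB_soliton A F \<rho> \<longleftrightarrow> gradient_RB_soliton A F \<rho> 0"

text \<open>Normalization: a \<open>d\<close>-dimensional space of constant curvature \<open>\<mu>\<close> has
  Einstein constant \<open>\<mu>\<close>, i.e. \<open>Ric = (d - 1) \<mu> g\<close>.\<close>
definition einstein :: "('p, 'e::euclidean_space) rchart set \<Rightarrow> real \<Rightarrow> bool" where
  "einstein A \<mu> \<longleftrightarrow>
     (\<forall>c\<in>A. \<forall>x\<in>chart_image c. \<forall>v w.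
        ricci (chart_metric c) x v w = (real DIM('e) - 1) * \<mu> * chart_metric c x v w)"

text \<open>Meaningful only for Einstein metrics, in dimension at least 2; the fibre of a warped product
  soliton with potential \<open>f(t)\<close> is always of this kind.\<close>
definition einstein_constant :: "('p, 'e::euclidean_space) rchart set \<Rightarrow> real" where
  "einstein_constant A = (THE \<mu>. einstein A \<mu>)"

definition ricci_flat :: "('p, 'e::euclidean_space) rchart set \<Rightarrow> bool" where
  "ricci_flat A \<longleftrightarrow>
     (\<forall>c\<in>A. \<forall>x\<in>chart_image c. \<forall>v w. ricci (chart_metric c) x v w = 0)"

text \<open>All sectional curvatures are \<open>\<kappa>\<close>; for linearly dependent \<open>u\<close>, \<open>v\<close> the equation is trivial.\<close>
definition constant_curvature :: "('p, 'e::euclidean_space) rchart set \<Rightarrow> real \<Rightarrow> bool" where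
  "constant_curvature A \<kappa> \<longleftrightarrow>
     (\<forall>c\<in>A. \<forall>x\<in>chart_image c. \<forall>u v.
        chart_metric c x (riemann_curv (chart_metric c) x u v v) u =
        \<kappa> * (chart_metric c x u u * chart_metric c x v v - (chart_metric c x u v)\<^sup>2))"

section \<open>Riemannian distance and completeness\<close>

definition piecewise_C1_curve ::
    "('p::topological_space, 'e::euclidean_space) rchart set \<Rightarrow> (real \<Rightarrow> 'p) \<Rightarrow> bool" where
  "piecewise_C1_curve A \<gamma> \<longleftrightarrow>
     continuous_on {0..1} \<gamma> \<and>
     (\<exists>N. finite N \<and>
        (\<forall>c\<in>A. (chart_map c \<circ> \<gamma>) C1_differentiable_on ({s\<in>{0<..<1}. \<gamma> s \<in> chart_dom c} - N)))"

text \<open>By the transformation law the speed does not depend on the selected chart.\<close>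
definition chart_at :: "('p, 'e) rchart set \<Rightarrow> 'p \<Rightarrow> ('p, 'e) rchart" where
  "chart_at A p = (SOME c. c \<in> A \<and> p \<in> chart_dom c)"

definition speed :: "('p, 'e::euclidean_space) rchart set \<Rightarrow> (real \<Rightarrow> 'p) \<Rightarrow> real \<Rightarrow> real" where
  "speed A \<gamma> s =
     (let c = chart_at A (\<gamma> s);
          u = vector_derivative (chart_map c \<circ> \<gamma>) (at s)
      in sqrt (chart_metric c (chart_map c (\<gamma> s)) u u))"

definition curve_length :: "('p, 'e::euclidean_space) rchart set \<Rightarrow> (real \<Rightarrow> 'p) \<Rightarrow> ennreal" where
  "curve_length A \<gamma> = (\<integral>\<^sup>+ s\<in>{0..1}. ennreal (speed A \<gamma> s) \<partial>lborel)"

text \<open>The distance is \<open>\<infinity>\<close> between points of different components.\<close>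
definition riem_dist ::
    "('p::topological_space, 'e::euclidean_space) rchart set \<Rightarrow> 'p \<Rightarrow> 'p \<Rightarrow> ennreal" where
  "riem_dist A p q =
     (INF \<gamma>\<in>{\<gamma>. piecewise_C1_curve A \<gamma> \<and> \<gamma> 0 = p \<and> \<gamma> 1 = q}. curve_length A \<gamma>)"

definition riem_complete :: "('p::topological_space, 'e::euclidean_space) rchart set \<Rightarrow> bool" where
  "riem_complete A \<longleftrightarrow>
     (\<forall>X :: nat \<Rightarrow> 'p.
        (\<forall>\<epsilon>>0. \<exists>N. \<forall>i\<ge>N. \<forall>j\<ge>N. riem_dist A (X i) (X j) < \<epsilon>)
        \<longrightarrow> (\<exists>p. (\<lambda>i. riem_dist A (X i) p) \<longlonglongrightarrow> 0))"

section \<open>Warped products over the real line\<close>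

text \<open>The metric \<open>dt\<^sup>2 + (w t)\<^sup>2 g\<close> on \<open>\<real> \<times> M\<close>, in the product charts.\<close>

definition warped_chart ::
    "(real \<Rightarrow> real) \<Rightarrow> ('p, 'e) rchart \<Rightarrow> (real \<times> 'p, real \<times> 'e) rchart" where
  "warped_chart w c =
     RChart (UNIV \<times> chart_dom c) (\<lambda>(t, p). (t, chart_map c p))
       (\<lambda>(t, x) (a, u) (b, v). a * b + (w t)\<^sup>2 * chart_metric c x u v)"

definition warped_product ::
    "(real \<Rightarrow> real) \<Rightarrow> ('p, 'e) rchart set \<Rightarrow> (real \<times> 'p, real \<times> 'e) rchart set" where
  "warped_product w A = warped_chart w ` A"

section \<open>The explicit solutions\<close>

text \<open>\<open>w\<close> is the warping function and \<open>\<phi>\<close> the derivative of the potential.  The isometry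
  \<open>t \<mapsto> -t\<close> turns the pair \<open>(w, \<phi>)\<close> into \<open>(\<lambda>t. w (-t), \<lambda>t. - \<phi> (-t))\<close>; the signs of
  \<open>B\<close>, \<open>C\<close>, \<open>D\<close> below can only be fixed up to this change of orientation.\<close>
definition explicit_solution ::
    "nat \<Rightarrow> real \<Rightarrow> real \<Rightarrow> real \<Rightarrow> real \<Rightarrow> (real \<Rightarrow> real) \<Rightarrow> (real \<Rightarrow> real) \<Rightarrow> bool" where
  "explicit_solution n B C D E w \<phi> \<longleftrightarrow>
     E = w 0 \<and>
     (\<forall>t. w t = ((B / D + E ^ (n - 1)) * exp (real (n - 1) * D * t) - B / D) powr (1 / real (n - 1))) \<and>
     (\<forall>t. \<phi> t = C * w t powr (1 - real n))"

text \<open>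
  The constants: \<open>B\<close> and \<open>C\<close> are not independent.  With \<open>w\<close> the warping function, \<open>u = w'/w\<close> and
  \<open>f' = C w\<^bsup>1-n\<^esup>\<close> the soliton equation with Ricci flat fibre becomes
  \<open>(n - 2) u' = - n f' u\<close>, that is \<open>u = D + B w\<^bsup>1-n\<^esup>\<close> with \<open>B = n C / ((n - 1) (n - 2))\<close>.
\<close>
definition admissible_constants :: "nat \<Rightarrow> real \<Rightarrow> real \<Rightarrow> real \<Rightarrow> real \<Rightarrow> bool" where
  "admissible_constants n B C D E \<longleftrightarrow>
     B > 0 \<and> C > 0 \<and> D < 0 \<and> E ^ (n - 1) > - (B / D) \<and>
     B = real n * C / (real (n - 1) * real (n - 2))"

end

theory Submission
  imports Defs
begin

text \<open>
  Write \<open>w = h'\<close> and \<open>u = w'/w\<close>.  The Ricci tensor of the warped product is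
  \<open>Ric\<^sub>* - (w w'' + (n-2) w'\<^sup>2) g\<^sub>* - (n-1) (w''/w) dt\<^sup>2\<close>, and the Hessian of \<open>f\<close> is
  \<open>f'' dt\<^sup>2 + f' w w' g\<^sub>*\<close>.  The \<open>dt\<^sup>2\<close> part of the soliton equation shows that the scalar curvature
  depends only on \<open>t\<close>, so the fibre part makes the fibre Einstein, hence Ricci flat as its Einstein
  constant vanishes.  What remains is equivalent to \<open>f'' + (n-1) f' u = 0\<close> (the trace) and
  \<open>(n-2) u' + n f' u = 0\<close>, with first integrals \<open>f' = C w\<^bsup>1-n\<^esup>\<close> and \<open>u = D + B w\<^bsup>1-n\<^esup>\<close>.  So
  \<open>y = w\<^bsup>n-1\<^esup>\<close> satisfies the linear equation \<open>y' = (n-1) (D y + B)\<close>, and its nonconstant solutions that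
  are positive on the whole line are the stated ones.

  A curve in the product projects to a curve in the line which is not longer, and, where \<open>w \<ge> m > 0\<close>, to a
  curve in the fibre which is at most \<open>1/m\<close> times as long.  Since \<open>w\<close> is bounded below near any point of the
  line, and globally for the explicit solutions, completeness passes to the fibre and back.
\<close>

section \<open>Dual vectors and their dependence on parameters\<close>

text \<open>Christoffel symbols are defined by a definite description and curvature by
  differentiating them, so no curvature formula can be expanded before dual vectors are known to
  exist, to be unique and to depend differentiably on the point. For the fibre this is proved in
  general; for the product the symbols are written down in closed form and recognized by uniqueness.
  With a Ricci flat fibre the Ricci tensor has one eigenvalue \<alpha> on the line and one
  eigenvalue \<beta> on the fibre, and \<alpha> - \<beta> = -(n-2) u'. The soliton equation says
  that \<alpha> + f'' and \<beta> + f' u both equal S/n; hence the factor n-2 and, on integrating,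
  the denominator (n-1)(n-2) of B. A solution y with D nonzero has the form K exp((n-1)Dt) - B/D,
  and positivity on the whole line makes K and -B/D nonnegative. Non-constancy of f' makes C, hence
  B, nonzero; that of w makes K nonzero, which is the condition on E. So -B/D is a positive lower
  bound of y, and this bound lets completeness return from the fibre.\<close>

lemma linear_eq_sum_Basis:
  fixes \<alpha> :: "'e::euclidean_space \<Rightarrow> 'b::real_vector"
  assumes "linear \<alpha>"
  shows "\<alpha> w = (\<Sum>e\<in>Basis. (w \<bullet> e) *\<^sub>R \<alpha> e)"
proof -
  have "\<alpha> (\<Sum>e\<in>Basis. (w \<bullet> e) *\<^sub>R e) = (\<Sum>e\<in>Basis. (w \<bullet> e) *\<^sub>R \<alpha> e)"
    by (simp add: linear_sum[OF assms] linear_cmul[OF assms])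
  then show ?thesis by (simp add: euclidean_representation)
qed

text \<open>Positive definiteness applied to the difference of two candidates. Later dual vectors
  are found by exhibiting a candidate and testing it against all \<open>w\<close>.\<close>

lemma sharp_unique:
  assumes "bilinear b" and pos: "\<And>v. v \<noteq> 0 \<Longrightarrow> b v v > 0" and eq: "\<And>w. b z w = \<alpha> w"
  shows "sharp b \<alpha> = z"
  unfolding sharp_def
proof (rule the_equality)
  show "\<forall>w. b z w = \<alpha> w" using eq by blast
next
  fix z' assume "\<forall>w. b z' w = \<alpha> w"
  then have "b (z' - z) (z' - z) = 0"
    by (simp add: eq bilinear_lsub[OF assms(1)])
  then show "z' = z" using pos[of "z' - z"] by force
qed

text \<open>Existence by dimension: the Gram operator \<open>T\<close> is injective by positivity,
  hence surjective, and a preimage of the coordinate vector of \<alpha> represents \<alpha>.\<close>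

lemma sharp_works:
  fixes b :: "'e::euclidean_space \<Rightarrow> 'e \<Rightarrow> real"
  assumes bil: "bilinear b" and pos: "\<And>v. v \<noteq> 0 \<Longrightarrow> b v v > 0" and lin: "linear \<alpha>"
  shows "b (sharp b \<alpha>) w = \<alpha> w"
proof -
  define T where "T z = (\<Sum>e\<in>Basis. b z e *\<^sub>R e)" for z
  have T_inner: "T z \<bullet> e = b z e" if "e \<in> Basis" for z e
    using that by (simp add: T_def)
  have T: "linear T"
    by (rule linearI)
       (simp_all add: T_def bilinear_ladd[OF bil] bilinear_lmul[OF bil] scaleR_add_left sum.distrib
         scaleR_sum_right)
  have repr: "b z w = T z \<bullet> w" for z w
  proof -
    have "linear (b z)" using bil by (simp add: bilinear_def)
    then show ?thesis
      by (simp add: linear_eq_sum_Basis[of "b z" w] euclidean_inner[of "T z" w] T_inner mult.commute)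
  qed
  have "inj T"
    unfolding linear_injective_0[OF T]
    by (metis inner_zero_left less_irrefl pos repr)
  then have "surj T" using T linear_inj_imp_surj by blast
  then obtain z where z: "T z = (\<Sum>e\<in>Basis. \<alpha> e *\<^sub>R e)" by (metis surjD)
  have "b z w = \<alpha> w" for w
    using linear_eq_sum_Basis[OF lin, of w]
    by (simp add: repr z inner_sum_left inner_commute[of w] mult.commute)
  then have "sharp b \<alpha> = z" by (intro sharp_unique[OF bil pos]) auto
  then show ?thesis using \<open>\<And>w. b z w = \<alpha> w\<close> by simp
qed

text \<open>\<open>g y\<close> is of order \<open>norm (y - x)\<close> and \<open>h y\<close> tends
  to 0, so the product is of smaller order. Asking only continuity of \<open>h\<close> is the point:
  it will be a component of a dual vector whose differentiability is still to be proved.\<close>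

lemma has_derivative_mult_zero:
  fixes g h :: "'a::real_normed_vector \<Rightarrow> real"
  assumes "g differentiable at x" "g x = 0" "isCont h x" "h x = 0"
  shows "((\<lambda>y. g y * h y) has_derivative (\<lambda>_. 0)) (at x)"
proof -
  obtain g' where g': "(g has_derivative g') (at x)"
    using assms(1) by (auto simp: differentiable_def)
  then obtain K where K: "\<And>v. norm (g' v) \<le> norm v * K"
    using bounded_linear.bounded has_derivative_bounded_linear by blast
  define F where "F y = norm (g y - g x - g' (y - x)) / norm (y - x)" for y
  have F: "(F \<longlongrightarrow> 0) (at x)"
    using g' by (simp add: F_def[abs_def] has_derivative_iff_norm)
  have h: "((\<lambda>y. \<bar>h y\<bar>) \<longlongrightarrow> 0) (at x)"
    using assms(3,4) by (simp add: isCont_def tendsto_rabs_zero)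
  have "((\<lambda>y. (F y + K) * \<bar>h y\<bar>) \<longlongrightarrow> (0 + K) * 0) (at x)"
    by (intro tendsto_intros F h)
  then have lim: "((\<lambda>y. (F y + K) * \<bar>h y\<bar>) \<longlongrightarrow> 0) (at x)" by simp
  have le: "norm (g y * h y) / norm (y - x) \<le> (F y + K) * \<bar>h y\<bar>" if "y \<noteq> x" for y
  proof -
    have "\<bar>g y\<bar> \<le> norm (g y - g x - g' (y - x)) + norm (g' (y - x))"
      using norm_triangle_ineq[of "g y - g x - g' (y - x)" "g' (y - x)"] assms(2) by simp
    also have "\<dots> \<le> (F y + K) * norm (y - x)"
      using K[of "y - x"] that by (simp add: F_def field_simps)
    finally have "\<bar>g y\<bar> / norm (y - x) \<le> F y + K" using that by (simp add: divide_simps)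
    then have "\<bar>g y\<bar> / norm (y - x) * \<bar>h y\<bar> \<le> (F y + K) * \<bar>h y\<bar>"
      by (intro mult_right_mono) auto
    then show ?thesis by (simp add: abs_mult)
  qed
  have "\<forall>\<^sub>F y in at x. norm (g y * h y) / norm (y - x) \<le> (F y + K) * \<bar>h y\<bar>"
    unfolding eventually_at_filter by (intro always_eventually allI impI le)
  then have "((\<lambda>y. norm (g y * h y) / norm (y - x)) \<longlongrightarrow> 0) (at x)"
    by (rule tendsto_sandwich[OF _ _ tendsto_const lim, rotated]) simp
  then show ?thesis using assms(2) by (simp add: has_derivative_iff_norm)
qed

text \<open>Write \<open>T y\<close> for the Gram matrix of \<open>G y\<close>, \<open>K\<close> for the inverse of \<open>T x\<close> and \<open>z y\<close> for the solution.  Then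
  \<open>z y - z x = p y - K ((T y - T x) (z y - z x))\<close> with \<open>p\<close> differentiable.  The second term is at most
  \<open>\<bar>z y - z x\<bar> / 2\<close> near \<open>x\<close>, so \<open>z\<close> is continuous at \<open>x\<close>; then the second term is \<open>o(y - x)\<close>.\<close>

lemma differentiable_sharp:
  fixes G :: "'a::real_normed_vector \<Rightarrow> 'e::euclidean_space \<Rightarrow> 'e \<Rightarrow> real"
  assumes "open U" "x \<in> U"
    and bil: "\<And>y. y \<in> U \<Longrightarrow> bilinear (G y)"
    and pos: "\<And>y v. y \<in> U \<Longrightarrow> v \<noteq> 0 \<Longrightarrow> G y v v > 0"
    and lin: "\<And>y. y \<in> U \<Longrightarrow> linear (\<alpha> y)"
    and dG: "\<And>v w. (\<lambda>y. G y v w) differentiable at x"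
    and d\<alpha>: "\<And>w. (\<lambda>y. \<alpha> y w) differentiable at x"
  shows "(\<lambda>y. sharp (G y) (\<alpha> y)) differentiable at x"
proof -
  define z where "z y = sharp (G y) (\<alpha> y)" for y
  have z: "G y (z y) w = \<alpha> y w" if "y \<in> U" for y w
    unfolding z_def by (rule sharp_works[OF bil pos lin]) (use that in auto)
  define k where "k e = sharp (G x) (\<lambda>w. w \<bullet> e)" for e
  have linx: "linear (G x v)" for v using bil[OF assms(2)] by (simp add: bilinear_def)
  have lin_inner: "linear (\<lambda>w. w \<bullet> e)" for e :: 'e
    by (intro bounded_linear.linear bounded_linear_inner_left)
  have k: "G x (k e) w = w \<bullet> e" for e w
    unfolding k_def by (rule sharp_works[OF bil pos lin_inner]) (use assms in auto)
  have inv: "v = (\<Sum>e\<in>Basis. G x v e *\<^sub>R k e)" for v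
  proof -
    let ?u = "\<Sum>e\<in>Basis. G x v e *\<^sub>R k e"
    have "G x ?u w = G x v w" for w
    proof -
      have "linear (\<lambda>u. G x u w)" using bil[OF assms(2)] by (simp add: bilinear_def)
      have "G x ?u w = (\<Sum>e\<in>Basis. G x v e * G x (k e) w)"
        by (simp add: linear_sum[OF \<open>linear (\<lambda>u. G x u w)\<close>] linear_cmul[OF \<open>linear (\<lambda>u. G x u w)\<close>])
      also have "\<dots> = (\<Sum>e\<in>Basis. (w \<bullet> e) *\<^sub>R G x v e)" by (simp add: k mult.commute)
      also have "\<dots> = G x v w" by (rule linear_eq_sum_Basis[OF linx, symmetric])
      finally show ?thesis .
    qed
    then have "sharp (G x) (G x v) = ?u" "sharp (G x) (G x v) = v"
      using assms by (auto intro!: sharp_unique bil pos)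
    then show ?thesis by simp
  qed
  define p where "p y = (\<Sum>e\<in>Basis. (\<alpha> y e - \<alpha> x e - (G y (z x) e - G x (z x) e)) *\<^sub>R k e)" for y
  define r where "r y = (\<Sum>e\<in>Basis. \<Sum>i\<in>Basis. ((G y i e - G x i e) * ((z y - z x) \<bullet> i)) *\<^sub>R k e)" for y
  have split: "z y - z x = p y - r y" if y: "y \<in> U" for y
  proof -
    have lin1: "linear (\<lambda>u. G y u e - G x u e)" for e
      using bil[OF y] bil[OF assms(2)]
      by (intro linear_compose_sub) (auto simp: bilinear_def)
    have "G x (z y - z x) e = (\<alpha> y e - \<alpha> x e - (G y (z x) e - G x (z x) e))
            - (\<Sum>i\<in>Basis. (G y i e - G x i e) * ((z y - z x) \<bullet> i))" for e
    proof -
      have "(\<Sum>i\<in>Basis. (G y i e - G x i e) * ((z y - z x) \<bullet> i)) = G y (z y - z x) e - G x (z y - z x) e"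
        using linear_eq_sum_Basis[OF lin1, of "z y - z x" e] by (simp add: mult.commute)
      then show ?thesis
        using z[OF y, of e] z[OF assms(2), of e]
        by (simp add: bilinear_lsub[OF bil[OF y]] bilinear_lsub[OF bil[OF assms(2)]])
    qed
    then show ?thesis
      unfolding p_def r_def
      by (subst inv) (simp add: scaleR_diff_left sum_subtractf scaleR_sum_left)
  qed
  have p_diff: "p differentiable at x"
    unfolding p_def
    by (intro derivative_intros differentiable_sum ballI differentiable_scaleR differentiable_diff
          d\<alpha> dG differentiable_const finite_Basis)
  have p0: "p x = 0" by (simp add: p_def)
  \<comment> \<open>\<open>q y\<close> bounds the norm of the inverse Gram matrix at
    \<open>x\<close> times the change of the Gram matrix. It is continuous and vanishes at
    \<open>x\<close>; below 1/2 it lets \<open>r y\<close> be absorbed into the left side.\<close>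
  define q where "q y = (\<Sum>e\<in>Basis. \<Sum>i\<in>Basis. \<bar>G y i e - G x i e\<bar> * norm (k e))" for y
  have dGc: "isCont (\<lambda>y. G y v w) x" for v w by (rule differentiable_imp_continuous_within[OF dG])
  have "isCont q x" unfolding q_def by (intro continuous_intros dGc)
  then have "(q \<longlongrightarrow> 0) (at x)" by (simp add: isCont_def q_def)
  then have "\<forall>\<^sub>F y in at x. q y < 1/2" by (rule order_tendstoD) simp
  moreover have "\<forall>\<^sub>F y in at x. y \<in> U" using assms by (simp add: eventually_at_in_open')
  ultimately have bound: "\<forall>\<^sub>F y in at x. norm (z y - z x) \<le> 2 * norm (p y)"
  proof eventually_elim
    case (elim y)
    have "norm (r y) \<le> (\<Sum>e\<in>Basis. \<Sum>i\<in>Basis. (\<bar>G y i e - G x i e\<bar> * norm (k e)) * norm (z y - z x))"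
      unfolding r_def
    proof (intro sum_norm_le)
      fix e i :: 'e assume "i \<in> Basis"
      then have "\<bar>(z y - z x) \<bullet> i\<bar> \<le> norm (z y - z x)" by (rule Basis_le_norm)
      then have "\<bar>G y i e - G x i e\<bar> * norm (k e) * \<bar>(z y - z x) \<bullet> i\<bar>
          \<le> \<bar>G y i e - G x i e\<bar> * norm (k e) * norm (z y - z x)"
        by (intro mult_left_mono) auto
      then show "norm (((G y i e - G x i e) * ((z y - z x) \<bullet> i)) *\<^sub>R k e)
          \<le> \<bar>G y i e - G x i e\<bar> * norm (k e) * norm (z y - z x)"
        by (simp add: abs_mult mult_ac)
    qed
    also have "\<dots> = q y * norm (z y - z x)" by (simp add: q_def sum_distrib_right)
    also have "\<dots> \<le> 1/2 * norm (z y - z x)" using elim by (intro mult_right_mono) auto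
    finally show ?case
      using split[OF elim(2)] norm_triangle_ineq4[of "p y" "r y"] by simp
  qed
  have "(p \<longlongrightarrow> 0) (at x)"
    using differentiable_imp_continuous_within[OF p_diff] p0 by (simp add: isCont_def continuous_within)
  then have "((\<lambda>y. 2 * norm (p y)) \<longlongrightarrow> 0) (at x)" by (auto intro!: tendsto_eq_intros)
  then have "((\<lambda>y. z y - z x) \<longlongrightarrow> 0) (at x)"
    using bound by (rule Lim_null_comparison[rotated])
  then have zc: "isCont z x" by (simp add: isCont_def LIM_zero_iff)
  have "((\<lambda>y. (G y i e - G x i e) * ((z y - z x) \<bullet> i)) has_derivative (\<lambda>_. 0)) (at x)" for i e
    by (rule has_derivative_mult_zero)
       (auto intro!: differentiable_diff dG continuous_intros zc)
  then have "(\<lambda>y. (G y i e - G x i e) * ((z y - z x) \<bullet> i)) differentiable at x" for i e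
    by (auto simp: differentiable_def)
  then have "r differentiable at x"
    unfolding r_def by (intro differentiable_sum differentiable_scaleR ballI) auto
  then have "(\<lambda>y. z x + (p y - r y)) differentiable at x"
    using p_diff by (intro differentiable_add differentiable_diff) auto
  then obtain D where "((\<lambda>y. z x + (p y - r y)) has_derivative D) (at x)"
    by (auto simp: differentiable_def)
  then have "(z has_derivative D) (at x)"
    by (rule has_derivative_transform_within_open[OF _ assms(1,2)]) (simp add: split[symmetric])
  then show ?thesis by (auto simp: differentiable_def z_def[abs_def])
qed

section \<open>Curvature of warped products in coordinates\<close>

lemma sum_Basis_prod:
  fixes f :: "'a::euclidean_space \<times> 'b::euclidean_space \<Rightarrow> 'c::comm_monoid_add"
  shows "sum f Basis = (\<Sum>i\<in>Basis. f (i, 0)) + (\<Sum>i\<in>Basis. f (0, i))"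
proof -
  have "inj_on (\<lambda>u. (u::'a, 0::'b)) Basis" "inj_on (\<lambda>u. (0::'a, u::'b)) Basis"
    by (auto intro!: inj_onI Pair_inject)
  then show ?thesis
    unfolding Basis_prod_def
    by (subst sum.union_disjoint) (auto simp: sum.reindex)
qed

lemma smooth_onD_differentiable:
  assumes "smooth_on S F" "x \<in> S"
  shows "F differentiable at x"
  using assms by (metis Ck_on.simps(2) smooth_on_def)

lemma smooth_onD_derivative:
  assumes "smooth_on S F"
  shows "smooth_on S (\<lambda>x. frechet_derivative F (at x) v)"
  using assms by (metis Ck_on.simps(2) smooth_on_def)

lemma frechet_derivative_cong_open:
  assumes "open U" "x \<in> U" "\<And>y. y \<in> U \<Longrightarrow> F y = H y"
  shows "frechet_derivative F (at x) = frechet_derivative H (at x)"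
proof -
  have "(F has_derivative D) (at x) \<longleftrightarrow> (H has_derivative D) (at x)" for D
    using assms has_derivative_transform_within_open[of F D x UNIV U H]
      has_derivative_transform_within_open[of H D x UNIV U F] by auto
  then show ?thesis by (simp add: frechet_derivative_def)
qed

section \<open>The Levi-Civita connection of a metric in one chart\<close>

locale smooth_metric =
  fixes U :: "'e::euclidean_space set" and G :: "'e \<Rightarrow> 'e \<Rightarrow> 'e \<Rightarrow> real"
  assumes open_domain: "open U"
    and smooth: "\<And>v w. smooth_on U (\<lambda>x. G x v w)"
    and bil: "\<And>x. x \<in> U \<Longrightarrow> bilinear (G x)"
    and sym: "\<And>x v w. x \<in> U \<Longrightarrow> G x v w = G x w v"
    and pos: "\<And>x v. x \<in> U \<Longrightarrow> v \<noteq> 0 \<Longrightarrow> G x v v > 0"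
begin

definition dG :: "'e \<Rightarrow> 'e \<Rightarrow> 'e \<Rightarrow> 'e \<Rightarrow> real" where
  "dG x v w u = frechet_derivative (\<lambda>y. G y v w) (at x) u"

lemma has_derivative_metric:
  assumes "x \<in> U"
  shows "((\<lambda>y. G y v w) has_derivative dG x v w) (at x)"
  using smooth_onD_differentiable[OF smooth assms] unfolding dG_def
  by (simp add: frechet_derivative_works)

lemma linear_dG: "x \<in> U \<Longrightarrow> linear (dG x v w)"
  using has_derivative_metric has_derivative_linear by blast

lemma dG_sym: "x \<in> U \<Longrightarrow> dG x v w = dG x w v"
  unfolding dG_def by (intro ext frechet_derivative_cong_open[OF open_domain, THEN fun_cong] sym)

lemma dG_unique:
  assumes "x \<in> U" "(F has_derivative D) (at x)" "\<And>y. y \<in> U \<Longrightarrow> F y = G y v w"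
  shows "dG x v w = D"
proof -
  have "((\<lambda>y. G y v w) has_derivative D) (at x)"
    using assms(3) by (rule has_derivative_transform_within_open[OF assms(2) open_domain assms(1)])
  then show ?thesis
    using has_derivative_metric[OF assms(1)] has_derivative_unique by blast
qed

lemma linear_dG_right: "x \<in> U \<Longrightarrow> linear (\<lambda>w. dG x v w u)"
proof (rule linearI)
  fix w w' and r :: real assume x: "x \<in> U"
  have "dG x v (w + w') = (\<lambda>u. dG x v w u + dG x v w' u)"
    by (rule dG_unique[OF x has_derivative_add[OF has_derivative_metric[OF x] has_derivative_metric[OF x]]])
       (simp add: bilinear_radd[OF bil])
  then show "dG x v (w + w') u = dG x v w u + dG x v w' u" by simp
  have "dG x v (r *\<^sub>R w) = (\<lambda>u. r *\<^sub>R dG x v w u)"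
    by (rule dG_unique[OF x has_derivative_scaleR_right[OF has_derivative_metric[OF x]]])
       (simp add: bilinear_rmul[OF bil])
  then show "dG x v (r *\<^sub>R w) u = r *\<^sub>R dG x v w u" by simp
qed

lemma linear_dG_left: "x \<in> U \<Longrightarrow> linear (\<lambda>v. dG x v w u)"
  using linear_dG_right[of x w u] by (simp add: dG_sym[of x _ w])

lemma differentiable_dG: "x \<in> U \<Longrightarrow> (\<lambda>y. dG y v w u) differentiable at x"
  unfolding dG_def by (rule smooth_onD_differentiable[OF smooth_onD_derivative[OF smooth]])

abbreviation \<Gamma> :: "'e \<Rightarrow> 'e \<Rightarrow> 'e \<Rightarrow> 'e" where
  "\<Gamma> \<equiv> christoffel G"

lemma christoffel_eq_sharp:
  "\<Gamma> x v w = sharp (G x) (\<lambda>z. (dG x w z v + dG x v z w - dG x v w z) / 2)"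
  by (simp add: christoffel_def dG_def)

lemma linear_koszul:
  "x \<in> U \<Longrightarrow> linear (\<lambda>z. (dG x w z v + dG x v z w - dG x v w z) / 2)"
  by (rule linearI)
     (simp_all add: linear_add[OF linear_dG] linear_add[OF linear_dG_right]
       linear_cmul[OF linear_dG] linear_cmul[OF linear_dG_right] field_simps)

text \<open>The Koszul formula for coordinate-constant fields, whose brackets vanish; its right side
  is linear in \<open>z\<close>, so \<open>sharp\<close> does have its defining property.\<close>

lemma metric_christoffel:
  assumes "x \<in> U"
  shows "G x (\<Gamma> x v w) z = (dG x w z v + dG x v z w - dG x v w z) / 2"
  unfolding christoffel_eq_sharp
  by (rule sharp_works[OF bil[OF assms] pos[OF assms] linear_koszul[OF assms]])

lemma christoffel_unique:
  assumes "x \<in> U" "\<And>z. G x y z = (dG x w z v + dG x v z w - dG x v w z) / 2"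
  shows "\<Gamma> x v w = y"
  unfolding christoffel_eq_sharp by (rule sharp_unique[OF bil pos]) (use assms in auto)

lemma christoffel_sym: "x \<in> U \<Longrightarrow> \<Gamma> x v w = \<Gamma> x w v"
  by (rule christoffel_unique) (simp_all add: metric_christoffel dG_sym[of x v w])

lemma linear_christoffel:
  assumes x: "x \<in> U"
  shows "linear (\<Gamma> x v)"
proof (rule linearI)
  fix w w' and r :: real
  show "\<Gamma> x v (w + w') = \<Gamma> x v w + \<Gamma> x v w'"
    by (rule christoffel_unique[OF x])
       (simp add: bilinear_ladd[OF bil[OF x]] metric_christoffel[OF x] linear_add[OF linear_dG[OF x]]
         linear_add[OF linear_dG_right[OF x]] linear_add[OF linear_dG_left[OF x]] field_simps)
  show "\<Gamma> x v (r *\<^sub>R w) = r *\<^sub>R \<Gamma> x v w"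
    by (rule christoffel_unique[OF x])
       (simp add: bilinear_lmul[OF bil[OF x]] metric_christoffel[OF x] linear_cmul[OF linear_dG[OF x]]
         linear_cmul[OF linear_dG_right[OF x]] linear_cmul[OF linear_dG_left[OF x]] field_simps)
qed

text \<open>The Koszul form contains first derivatives of a smooth metric, so it is differentiable,
  and dualizing preserves this. It allows the derivatives in the curvature of the product to be
  split into fibre and warping parts.\<close>

lemma differentiable_christoffel:
  assumes x: "x \<in> U"
  shows "(\<lambda>y. \<Gamma> y v w) differentiable at x"
  unfolding christoffel_eq_sharp
  by (rule differentiable_sharp[OF open_domain x bil pos linear_koszul])
     (auto intro!: differentiable_divide differentiable_add differentiable_diff differentiable_dG x
       smooth_onD_differentiable[OF smooth])

end

lemma local_riemannian_imp_smooth_metric: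
  assumes "local_riemannian c"
  shows "smooth_metric (chart_image c) (chart_metric c)"
  using assms unfolding local_riemannian_def smooth_metric_def by blast

section \<open>Connection, Ricci tensor and Hessian of the warped metric\<close>

definition warped_metric ::
    "(real \<Rightarrow> real) \<Rightarrow> ('e \<Rightarrow> 'e \<Rightarrow> 'e \<Rightarrow> real) \<Rightarrow> real \<times> 'e \<Rightarrow> real \<times> 'e \<Rightarrow> real \<times> 'e \<Rightarrow> real" where
  "warped_metric w G = (\<lambda>(t, x) (a, u) (b, v). a * b + (w t)\<^sup>2 * G x u v)"

lemma warped_metric_apply [simp]:
  "warped_metric w G (t, x) (a, u) (b, v) = a * b + (w t)\<^sup>2 * G x u v"
  by (simp add: warped_metric_def)

text \<open>Only the fibre metric is an instance of \<open>smooth_metric\<close>. For the product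
  metric \<open>W\<close> bilinearity and positivity are enough, because its dual vectors are all
  given explicitly.\<close>

locale warped_smooth_metric = smooth_metric U G
  for U :: "'e::euclidean_space set" and G +
  fixes w w1 w2 :: "real \<Rightarrow> real"
  assumes w1: "\<And>t. (w has_real_derivative w1 t) (at t)"
    and w2: "\<And>t. (w1 has_real_derivative w2 t) (at t)"
    and w_pos: "\<And>t. w t > 0"
begin

abbreviation W where "W \<equiv> warped_metric w G"

lemma bilinear_warped: "x \<in> U \<Longrightarrow> bilinear (W (t, x))"
  unfolding bilinear_def
  by (intro conjI allI linearI)
     (auto simp: warped_metric_def split_beta bilinear_ladd[OF bil] bilinear_radd[OF bil]
       bilinear_lmul[OF bil] bilinear_rmul[OF bil] algebra_simps)

lemma warped_pos:
  assumes "x \<in> U" "V \<noteq> 0"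
  shows "W (t, x) V V > 0"
proof (cases V)
  case (Pair a v)
  show ?thesis
  proof (cases "v = 0")
    case True
    then show ?thesis using assms Pair by (simp add: bilinear_lzero[OF bil[OF assms(1)]] zero_prod_def power2_eq_square[symmetric])
  next
    case False
    then show ?thesis using pos[OF assms(1) False] w_pos[of t] Pair
      by (simp add: add_nonneg_pos power2_eq_square[symmetric])
  qed
qed

lemma frechet_warped:
  assumes x: "x \<in> U"
  shows "frechet_derivative (\<lambda>y. W y (b, v) (c, z)) (at (t, x)) (a, u)
    = 2 * w t * w1 t * a * G x v z + (w t)\<^sup>2 * dG x v z u"
proof -
  have "(fst has_derivative fst) (at (t, x))" and snd: "(snd has_derivative snd) (at (t, x))"
    by (simp_all add: bounded_linear_imp_has_derivative bounded_linear_fst bounded_linear_snd)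
  from has_derivative_compose[OF this(1), of w "(*) (w1 t)"] w1[of t]
  have wd: "((\<lambda>y. w (fst y)) has_derivative (\<lambda>h. w1 t * fst h)) (at (t, x))"
    by (simp add: has_field_derivative_def)
  from has_derivative_compose[OF snd, of "\<lambda>y. G y v z" "dG x v z"] has_derivative_metric[OF x]
  have Gd: "((\<lambda>y. G (snd y) v z) has_derivative (\<lambda>h. dG x v z (snd h))) (at (t, x))"
    by simp
  have "((\<lambda>y. b * c + (w (fst y))\<^sup>2 * G (snd y) v z) has_derivative
     (\<lambda>h. 2 * w t * w1 t * fst h * G x v z + (w t)\<^sup>2 * dG x v z (snd h))) (at (t, x))"
    by (rule derivative_eq_intros wd Gd refl | simp)+ (auto simp: algebra_simps fun_eq_iff)
  then have "((\<lambda>y. W y (b, v) (c, z)) has_derivative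
     (\<lambda>h. 2 * w t * w1 t * fst h * G x v z + (w t)\<^sup>2 * dG x v z (snd h))) (at (t, x))"
    by (simp add: warped_metric_def split_beta)
  then show ?thesis by (simp add: frechet_derivative_at[symmetric])
qed

text \<open>A line vector and a fibre vector combine with the factor w'/w, and the line component -w
  w' G is the second fundamental form of the slices. The candidate is tested in the Koszul formula
  against every \<open>Z\<close>.\<close>

lemma christoffel_warped:
  assumes x: "x \<in> U"
  shows "christoffel W (t, x) (a, u) (b, v)
    = (- w t * w1 t * G x u v, \<Gamma> x u v + (w1 t / w t) *\<^sub>R (a *\<^sub>R v + b *\<^sub>R u))"
  unfolding christoffel_def[of W]
proof (rule sharp_unique, rule bilinear_warped[OF x], rule warped_pos[OF x], assumption)
  fix Z :: "real \<times> 'e"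
  obtain c z where Z: "Z = (c, z)" by fastforce
  have w: "w t \<noteq> 0" using w_pos[of t] by simp
  show "W (t, x) (- w t * w1 t * G x u v, \<Gamma> x u v + (w1 t / w t) *\<^sub>R (a *\<^sub>R v + b *\<^sub>R u)) Z =
     (frechet_derivative (\<lambda>y. W y (b, v) Z) (at (t, x)) (a, u)
      + frechet_derivative (\<lambda>y. W y (a, u) Z) (at (t, x)) (b, v)
      - frechet_derivative (\<lambda>y. W y (a, u) (b, v)) (at (t, x)) Z) / 2"
    unfolding Z frechet_warped[OF x]
    using w by (simp add: bilinear_ladd[OF bil[OF x]] bilinear_lmul[OF bil[OF x]] metric_christoffel[OF x]
        field_simps power2_eq_square)
qed

text \<open>The closed form of the symbols holds on the open set \<open>UNIV \<times> U\<close> and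
  may be differentiated there. The new coefficients are the derivatives of -w w' and of
  w'/w.\<close>

lemma frechet_christoffel_warped:
  assumes x: "x \<in> U"
  shows "frechet_derivative (\<lambda>y. christoffel W y (b, v) (c, z)) (at (t, x)) (a, u) =
    (- ((w1 t)\<^sup>2 + w t * w2 t) * a * G x v z - w t * w1 t * dG x v z u,
     frechet_derivative (\<lambda>y. \<Gamma> y v z) (at x) u
       + (a * (w2 t / w t - (w1 t / w t)\<^sup>2)) *\<^sub>R (b *\<^sub>R z + c *\<^sub>R v))"
proof -
  let ?D = "frechet_derivative (\<lambda>y. \<Gamma> y v z) (at x)"
  have w: "w t \<noteq> 0" using w_pos[of t] by simp
  have fst: "(fst has_derivative fst) (at (t, x))" and snd: "(snd has_derivative snd) (at (t, x))"
    by (simp_all add: bounded_linear_imp_has_derivative bounded_linear_fst bounded_linear_snd)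
  have "((\<lambda>s. - w s * w1 s) has_real_derivative - ((w1 t)\<^sup>2 + w t * w2 t)) (at t)"
    by (auto intro!: derivative_eq_intros w1 w2 simp: power2_eq_square)
  from has_derivative_compose[OF fst, of _ "(*) (- ((w1 t)\<^sup>2 + w t * w2 t))"] this
  have d1: "((\<lambda>y. - w (fst y) * w1 (fst y)) has_derivative (\<lambda>h. - ((w1 t)\<^sup>2 + w t * w2 t) * fst h)) (at (t, x))"
    by (simp add: has_field_derivative_def)
  have "((\<lambda>s. w1 s / w s) has_real_derivative (w2 t / w t - (w1 t / w t)\<^sup>2)) (at t)"
    by (auto intro!: derivative_eq_intros w1 w2 w simp: w power2_eq_square field_simps)
  from has_derivative_compose[OF fst, of _ "(*) (w2 t / w t - (w1 t / w t)\<^sup>2)"] this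
  have d2: "((\<lambda>y. w1 (fst y) / w (fst y)) has_derivative (\<lambda>h. (w2 t / w t - (w1 t / w t)\<^sup>2) * fst h)) (at (t, x))"
    by (simp add: has_field_derivative_def)
  from has_derivative_compose[OF snd, of "\<lambda>y. G y v z" "dG x v z"] has_derivative_metric[OF x]
  have d3: "((\<lambda>y. G (snd y) v z) has_derivative (\<lambda>h. dG x v z (snd h))) (at (t, x))"
    by simp
  from has_derivative_compose[OF snd, of "\<lambda>y. \<Gamma> y v z" ?D] differentiable_christoffel[OF x]
  have d4: "((\<lambda>y. \<Gamma> (snd y) v z) has_derivative (\<lambda>h. ?D (snd h))) (at (t, x))"
    by (simp add: frechet_derivative_works)
  let ?F = "\<lambda>y. (- w (fst y) * w1 (fst y) * G (snd y) v z,
      \<Gamma> (snd y) v z + (w1 (fst y) / w (fst y)) *\<^sub>R (b *\<^sub>R z + c *\<^sub>R v))"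
  have "(?F has_derivative
     (\<lambda>h. (- w t * w1 t * dG x v z (snd h) + - ((w1 t)\<^sup>2 + w t * w2 t) * fst h * G x v z,
       ?D (snd h) + ((w2 t / w t - (w1 t / w t)\<^sup>2) * fst h) *\<^sub>R (b *\<^sub>R z + c *\<^sub>R v)))) (at (t, x))"
    using has_derivative_Pair[OF has_derivative_mult[OF d1 d3]
        has_derivative_add[OF d4 has_derivative_scaleR_left[OF d2]]]
    by simp
  moreover have "frechet_derivative (\<lambda>y. christoffel W y (b, v) (c, z)) (at (t, x))
      = frechet_derivative ?F (at (t, x))"
    by (rule frechet_derivative_cong_open[of "UNIV \<times> U"])
       (use x in \<open>auto simp: open_Times open_domain christoffel_warped\<close>)
  ultimately show ?thesis
    by (simp add: frechet_derivative_at[symmetric] algebra_simps)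
qed

lemma linear_christoffel_left: "x \<in> U \<Longrightarrow> linear (\<lambda>v. \<Gamma> x v u)"
  using linear_christoffel[of x u] by (simp add: christoffel_sym[of x _ u])

text \<open>The Ricci tensor is a trace over the first vector slot, so two diagonal blocks suffice:
  the line component for the line direction here, and the fibre component for fibre directions in
  \<open>riemann_warped_vertical\<close>.\<close>

lemma riemann_warped_horizontal:
  assumes x: "x \<in> U"
  shows "fst (riemann_curv W (t, x) (1, 0) (b, v) (c, z)) = - w t * w2 t * G x v z"
proof -
  have w: "w t \<noteq> 0" using w_pos[of t] by simp
  show ?thesis
    unfolding riemann_curv_def frechet_christoffel_warped[OF x] christoffel_warped[OF x]
    using w by (simp add: bilinear_lzero[OF bil[OF x]] bilinear_rzero[OF bil[OF x]]
        linear_0[OF linear_dG[OF x]] linear_0[OF linear_dG_right[OF x]] linear_0[OF linear_dG_left[OF x]]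
        linear_0[OF linear_christoffel[OF x]] linear_0[OF linear_christoffel_left[OF x]]
        bilinear_rmul[OF bil[OF x]] field_simps power2_eq_square)
qed

text \<open>For fibre vectors this is the Gauss equation of a slice, the term with
  \<open>(w1 t)\<^sup>2\<close> being quadratic in its second fundamental form. The term with
  \<open>b * c\<close> is the radial curvature -w''/w.\<close>

lemma riemann_warped_vertical:
  assumes x: "x \<in> U"
  shows "snd (riemann_curv W (t, x) (0, e) (b, v) (c, z)) =
    riemann_curv G x e v z - (w1 t)\<^sup>2 *\<^sub>R (G x v z *\<^sub>R e - G x e z *\<^sub>R v) - (b * c * w2 t / w t) *\<^sub>R e"
proof -
  have w: "w t \<noteq> 0" using w_pos[of t] by simp
  have k: "(w1 t / w t) * (w t * w1 t) = (w1 t)\<^sup>2" using w by (simp add: power2_eq_square)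
  show ?thesis
    unfolding riemann_curv_def frechet_christoffel_warped[OF x] christoffel_warped[OF x]
    by (simp add: linear_add[OF linear_christoffel[OF x]] linear_cmul[OF linear_christoffel[OF x]]
        christoffel_sym[OF x, of e v] algebra_simps k)
       (use w in \<open>simp add: algebra_simps power2_eq_square\<close>)
qed

text \<open>The map taking e to G(e,z) v has trace G(v,z), so the factor of w'^2 is the fibre
  dimension \<open>DIM('e)\<close> minus one; the line direction contributes -w w''.\<close>

lemma ricci_warped:
  assumes x: "x \<in> U"
  shows "ricci W (t, x) (b, v) (c, z) = ricci G x v z
    - (w t * w2 t + (real DIM('e) - 1) * (w1 t)\<^sup>2) * G x v z - real DIM('e) * (w2 t / w t) * (b * c)"
proof -
  have lin: "linear (\<lambda>e. G x e z)" using bil[OF x] by (simp add: bilinear_def)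
  have "(\<Sum>e\<in>Basis. snd (riemann_curv W (t, x) (0, e) (b, v) (c, z)) \<bullet> e) =
     (\<Sum>e\<in>Basis. riemann_curv G x e v z \<bullet> e - (w1 t)\<^sup>2 * (G x v z - G x e z * (v \<bullet> e)) - b * c * w2 t / w t)"
    by (rule sum.cong) (simp_all add: riemann_warped_vertical[OF x] inner_diff_left)
  also have "\<dots> = ricci G x v z
      - (w1 t)\<^sup>2 * (real DIM('e) * G x v z - (\<Sum>e\<in>Basis. G x e z * (v \<bullet> e))) - real DIM('e) * (b * c * w2 t / w t)"
    by (simp add: ricci_def sum_subtractf sum_distrib_left[symmetric])
  also have "(\<Sum>e\<in>Basis. G x e z * (v \<bullet> e)) = G x v z"
    using linear_eq_sum_Basis[OF lin, of v] by (simp add: mult.commute)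
  finally have vert: "(\<Sum>e\<in>Basis. snd (riemann_curv W (t, x) (0, e) (b, v) (c, z)) \<bullet> e)
      = ricci G x v z - (w1 t)\<^sup>2 * (real DIM('e) * G x v z - G x v z) - real DIM('e) * (b * c * w2 t / w t)" .
  show ?thesis
    unfolding ricci_def[of W] sum_Basis_prod
    by (simp add: inner_prod_def riemann_warped_horizontal[OF x] vert)
       (simp add: algebra_simps)
qed

text \<open>The hypothesis makes the Ricci tensor diagonal, with eigenvalue \<alpha> on the line and
  \<beta> on the fibre, so its dual vectors can be named. It is available once the fibre is Ricci
  flat; before that the scalar curvature is treated as an unknown.\<close>

lemma scalar_curv_warped:
  assumes x: "x \<in> U"
    and ric: "\<And>b v c z. ricci W (t, x) (b, v) (c, z) = \<alpha> * (b * c) + \<beta> * ((w t)\<^sup>2 * G x v z)"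
  shows "scalar_curv W (t, x) = \<alpha> + real DIM('e) * \<beta>"
proof -
  have "sharp (W (t, x)) (ricci W (t, x) (b, v)) = (\<alpha> * b, \<beta> *\<^sub>R v)" for b v
  proof (rule sharp_unique, rule bilinear_warped[OF x], rule warped_pos[OF x], assumption)
    fix Z show "W (t, x) (\<alpha> * b, \<beta> *\<^sub>R v) Z = ricci W (t, x) (b, v) Z"
      by (cases Z) (simp add: ric bilinear_lmul[OF bil[OF x]])
  qed
  then show ?thesis
    unfolding scalar_curv_def sum_Basis_prod by (simp add: inner_prod_def)
qed

text \<open>The differential of a function of t sees only the line component -w w' G of the
  Christoffel symbol, which gives the fibre term. \<open>F\<close> is constrained only over
  \<open>U\<close>, because in the application it is built from \<open>chart_inv\<close>, which is
  meaningful only there.\<close>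

lemma hessian_warped:
  assumes x: "x \<in> U"
    and f1: "\<And>t. (f has_real_derivative f1 t) (at t)"
    and f2: "\<And>t. (f1 has_real_derivative f2 t) (at t)"
    and F: "\<And>t x. x \<in> U \<Longrightarrow> F (t, x) = f t"
  shows "hessian W F (t, x) (a, u) (b, v) = f2 t * (a * b) + f1 t * w t * w1 t * G x u v"
proof -
  have o: "open (UNIV \<times> U)" by (simp add: open_Times open_domain)
  have comp: "frechet_derivative (\<lambda>y. \<phi> (fst y)) (at (s, y)) = (\<lambda>h. \<phi>1 s * fst h)"
    if "\<And>t. (\<phi> has_real_derivative \<phi>1 t) (at t)" for \<phi> \<phi>1 s and y :: 'e
  proof -
    have "(fst has_derivative fst) (at (s, y))"
      by (simp add: bounded_linear_imp_has_derivative bounded_linear_fst)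
    from has_derivative_compose[OF this, of \<phi> "(*) (\<phi>1 s)"] that[of s]
    have "((\<lambda>y. \<phi> (fst y)) has_derivative (\<lambda>h. \<phi>1 s * fst h)) (at (s, y))"
      by (simp add: has_field_derivative_def)
    then show ?thesis by (simp add: frechet_derivative_at[symmetric])
  qed
  have dF: "frechet_derivative F (at y) = (\<lambda>h. f1 (fst y) * fst h)" if "y \<in> UNIV \<times> U" for y
  proof -
    have "frechet_derivative F (at y) = frechet_derivative (\<lambda>y. f (fst y)) (at y)"
      by (rule frechet_derivative_cong_open[OF o that]) (auto simp: F)
    then show ?thesis using comp[OF f1, of "fst y" "snd y"] by simp
  qed
  have "frechet_derivative (\<lambda>y. frechet_derivative F (at y) (b, v)) (at (t, x))
      = frechet_derivative (\<lambda>y. f1 (fst y) * b) (at (t, x))"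
    by (rule frechet_derivative_cong_open[OF o]) (use x in \<open>auto simp: dF\<close>)
  also have "\<dots> = (\<lambda>h. f2 t * b * fst h)"
    by (rule comp) (auto intro!: derivative_eq_intros f2)
  finally show ?thesis
    using x by (simp add: hessian_def dF christoffel_warped)
qed

end

section \<open>Distance and completeness of warped products\<close>

text \<open>If \<open>s \<le> u + c g\<close> is simple, then \<open>(s - u) / c\<close> is a measurable minorant of \<open>g\<close>.  The lemma is
  applied to speeds of curves, whose measurability is unclear because a chart is chosen at every point.\<close>

lemma nn_integral_affine_le:
  fixes u g :: "'a \<Rightarrow> ennreal" and c :: real
  assumes [measurable]: "u \<in> borel_measurable M" and fin: "\<And>x. u x \<noteq> top" and c: "c > 0"
  shows "(\<integral>\<^sup>+x. u x + ennreal c * g x \<partial>M) \<le> (\<integral>\<^sup>+x. u x \<partial>M) + ennreal c * (\<integral>\<^sup>+x. g x \<partial>M)"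
  unfolding nn_integral_def[of M "\<lambda>x. u x + ennreal c * g x"]
proof (rule SUP_least, elim CollectE conjE)
  fix s assume s: "simple_function M s" and le: "s \<le> (\<lambda>x. u x + ennreal c * g x)"
  define s' where "s' x = ennreal (1 / c) * (s x - u x)" for x
  have cc: "ennreal (1 / c) * ennreal c = 1" "ennreal c * ennreal (1 / c) = 1"
    using c by (simp_all add: ennreal_mult[symmetric])
  have [measurable]: "s \<in> borel_measurable M" using s by (rule borel_measurable_simple_function)
  have s'_meas: "s' \<in> borel_measurable M" unfolding s'_def[abs_def] by measurable
  have "s' x \<le> g x" for x
  proof -
    have "s x - u x \<le> ennreal c * g x"
      using le fin[of x] by (simp add: ennreal_minus_le_iff le_fun_def)
    then have "s' x \<le> ennreal (1 / c) * (ennreal c * g x)"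
      unfolding s'_def by (rule mult_left_mono) simp
    then show ?thesis by (simp add: mult.assoc[symmetric] cc)
  qed
  moreover have "s x \<le> u x + ennreal c * s' x" for x
  proof -
    have "ennreal c * s' x = s x - u x"
      by (simp add: s'_def mult.assoc[symmetric] cc)
    then show ?thesis
      by (metis add.commute add_diff_eq_ennreal diff_add_self_ennreal le_iff_add linear order_refl add_increasing zero_le)
  qed
  ultimately have "integral\<^sup>S M s \<le> (\<integral>\<^sup>+x. u x + ennreal c * s' x \<partial>M)"
    unfolding nn_integral_eq_simple_integral[OF s, symmetric] by (intro nn_integral_mono) auto
  also have "\<dots> = (\<integral>\<^sup>+x. u x \<partial>M) + ennreal c * (\<integral>\<^sup>+x. s' x \<partial>M)"
    using s'_meas by (simp add: nn_integral_add nn_integral_cmult)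
  also have "\<dots> \<le> (\<integral>\<^sup>+x. u x \<partial>M) + ennreal c * (\<integral>\<^sup>+x. g x \<partial>M)"
    using \<open>\<And>x. s' x \<le> g x\<close> by (intro add_left_mono mult_left_mono nn_integral_mono) auto
  finally show "integral\<^sup>S M s \<le> (\<integral>\<^sup>+x. u x \<partial>M) + ennreal c * (\<integral>\<^sup>+x. g x \<partial>M)" .
qed

text \<open>All length comparisons have this shape: \<open>a = 0\<close>, \<open>c = 1\<close> for
  the line component, \<open>a = 0\<close>, \<open>c = 1 / m\<close> for the projection to the
  fibre, and \<open>a\<close> the displacement on the line for lifts of fibre curves. The break
  points \<open>N\<close> and the end points form a null set.\<close>

lemma interval_integral_affine_le:
  fixes f g :: "real \<Rightarrow> real" and a c :: real
  assumes "finite N" "a \<ge> 0" "c > 0"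
    and le: "\<And>s. s \<in> {0<..<1} - N \<Longrightarrow> f s \<le> a + c * g s"
    and g0: "\<And>s. s \<in> {0<..<1} - N \<Longrightarrow> g s \<ge> 0"
  shows "(\<integral>\<^sup>+s\<in>{0..1}. ennreal (f s) \<partial>lborel) \<le> ennreal a + ennreal c * (\<integral>\<^sup>+s\<in>{0..1}. ennreal (g s) \<partial>lborel)"
proof -
  let ?I = "indicator {0..1::real} :: real \<Rightarrow> ennreal"
  have "N \<union> {0, 1} \<in> null_sets lborel" using assms(1) by (intro finite_imp_null_set_lborel) auto
  then have "AE s in lborel. s \<notin> N \<union> {0, 1}" by (rule AE_not_in)
  then have "AE s in lborel. ennreal (f s) * ?I s \<le> ennreal a * ?I s + ennreal c * (ennreal (g s) * ?I s)"
  proof (rule AE_mp, intro AE_I2 impI)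
    fix s assume s: "s \<notin> N \<union> {0, 1}"
    show "ennreal (f s) * ?I s \<le> ennreal a * ?I s + ennreal c * (ennreal (g s) * ?I s)"
    proof (cases "s \<in> {0..1}")
      case True
      then have s': "s \<in> {0<..<1} - N" using s by auto
      have "ennreal (f s) \<le> ennreal (a + c * g s)" using le[OF s'] by (rule ennreal_leI)
      also have "\<dots> = ennreal a + ennreal c * ennreal (g s)"
        using g0[OF s'] assms by (simp add: ennreal_plus ennreal_mult)
      finally show ?thesis using True by simp
    qed simp
  qed
  then have "(\<integral>\<^sup>+s\<in>{0..1}. ennreal (f s) \<partial>lborel)
      \<le> (\<integral>\<^sup>+s. ennreal a * ?I s + ennreal c * (ennreal (g s) * ?I s) \<partial>lborel)"
    by (rule nn_integral_mono_AE)
  also have "\<dots> \<le> (\<integral>\<^sup>+s. ennreal a * ?I s \<partial>lborel) + ennreal c * (\<integral>\<^sup>+s. ennreal (g s) * ?I s \<partial>lborel)"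
    by (rule nn_integral_affine_le) (use assms in \<open>auto simp: indicator_def\<close>)
  also have "(\<integral>\<^sup>+s. ennreal a * ?I s \<partial>lborel) = ennreal a"
    by (simp add: nn_integral_cmult_indicator)
  finally show ?thesis .
qed

text \<open>Near a point of \<open>N\<close> the derivative is uncontrolled and need not be Lebesgue
  integrable, so the fundamental theorem is applied to the gauge integral. If the integral of the
  absolute value is finite, both integrals agree; otherwise the right side is infinite.\<close>

lemma displacement_le_integral:
  fixes \<tau> :: "real \<Rightarrow> real"
  assumes cont: "continuous_on {0..1} \<tau>" and "finite N"
    and diff: "\<And>s. s \<in> {0<..<1} - N \<Longrightarrow> \<tau> differentiable at s" and b: "b \<in> {0..1}"
  shows "ennreal \<bar>\<tau> b - \<tau> 0\<bar> \<le> (\<integral>\<^sup>+s\<in>{0..1}. ennreal \<bar>vector_derivative \<tau> (at s)\<bar> \<partial>lborel)"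
proof -
  let ?d = "\<lambda>s. vector_derivative \<tau> (at s)"
  have ftc: "(?d has_integral (\<tau> b - \<tau> 0)) {0..b}"
  proof (rule fundamental_theorem_of_calculus_interior_strong[OF assms(2)])
    fix s assume "s \<in> {0<..<b} - N"
    then have "s \<in> {0<..<1} - N" using b by auto
    then show "(\<tau> has_vector_derivative ?d s) (at s)"
      using diff vector_derivative_works by blast
  qed (use b in \<open>auto intro: continuous_on_subset[OF cont]\<close>)
  have int_le: "(\<integral>\<^sup>+s. ennreal (norm (?d s)) \<partial>lebesgue_on {0..b}) \<le> (\<integral>\<^sup>+s\<in>{0..1}. ennreal \<bar>?d s\<bar> \<partial>lborel)"
  proof -
    have "(\<integral>\<^sup>+s. ennreal (norm (?d s)) \<partial>lebesgue_on {0..b})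
        = (\<integral>\<^sup>+s. ennreal (norm (?d s)) * indicator {0..b} s \<partial>lebesgue)"
      by (rule nn_integral_restrict_space) auto
    also have "\<dots> = (\<integral>\<^sup>+s. ennreal (norm (?d s)) * indicator {0..b} s \<partial>lborel)"
      by (rule nn_integral_completion)
    also have "\<dots> \<le> (\<integral>\<^sup>+s\<in>{0..1}. ennreal \<bar>?d s\<bar> \<partial>lborel)"
      using b by (intro nn_integral_mono) (auto simp: indicator_def)
    finally show ?thesis .
  qed
  show ?thesis
  proof (cases "(\<integral>\<^sup>+s. ennreal (norm (?d s)) \<partial>lebesgue_on {0..b}) < \<infinity>")
    case True
    then have int: "integrable (lebesgue_on {0..b}) ?d"
      using integrable_iff_integrable_on[OF _ True] ftc by (auto simp: has_integral_iff)
    then have "integral\<^sup>L (lebesgue_on {0..b}) ?d = \<tau> b - \<tau> 0"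
      using lebesgue_integral_eq_integral[OF int] ftc by (simp add: has_integral_iff)
    then show ?thesis
      using order_trans[OF integral_norm_bound_ennreal[OF int] int_le] by simp
  next
    case False
    then have "(\<integral>\<^sup>+s\<in>{0..1}. ennreal \<bar>?d s\<bar> \<partial>lborel) = top"
      using int_le False by (simp add: less_top[symmetric] top_unique)
    then show ?thesis by simp
  qed
qed

text \<open>Every positive extended real, infinity included, has a positive real below it; so real
  bounds with a non-strict inequality suffice. Distance estimates arise in this form.\<close>

lemma ennreal_null_sequence_iff:
  "(d \<longlonglongrightarrow> (0::ennreal)) \<longleftrightarrow> (\<forall>\<epsilon>>0. \<exists>N. \<forall>i\<ge>N. d i \<le> ennreal \<epsilon>)"
proof
  assume d: "d \<longlonglongrightarrow> 0"
  show "\<forall>\<epsilon>>0. \<exists>N. \<forall>i\<ge>N. d i \<le> ennreal \<epsilon>"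
  proof (intro allI impI)
    fix \<epsilon> :: real assume "\<epsilon> > 0"
    then have "\<forall>\<^sub>F i in sequentially. d i < ennreal \<epsilon>" using d by (intro order_tendstoD) auto
    then show "\<exists>N. \<forall>i\<ge>N. d i \<le> ennreal \<epsilon>"
      unfolding eventually_sequentially by (meson less_imp_le)
  qed
next
  assume *: "\<forall>\<epsilon>>0. \<exists>N. \<forall>i\<ge>N. d i \<le> ennreal \<epsilon>"
  show "d \<longlonglongrightarrow> 0"
  proof (rule order_tendstoI)
    fix a :: ennreal assume "0 < a"
    then obtain \<epsilon> where \<epsilon>: "0 < ennreal \<epsilon>" "ennreal \<epsilon> < a"
      by (metis dense ennreal_cases less_top_ennreal less_trans order_less_imp_not_less top_greatest not_less)
    with * obtain N where "\<forall>i\<ge>N. d i \<le> ennreal \<epsilon>" by auto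
    then show "\<forall>\<^sub>F i in sequentially. d i < a"
      unfolding eventually_sequentially using \<epsilon> by (meson le_less_trans)
  qed auto
qed


lemma riem_complete_iff:
  fixes A :: "('p::topological_space, 'e::euclidean_space) rchart set"
  shows "riem_complete A \<longleftrightarrow>
     (\<forall>X :: nat \<Rightarrow> 'p. (\<forall>\<epsilon>>0. \<exists>N. \<forall>i\<ge>N. \<forall>j\<ge>N. riem_dist A (X i) (X j) \<le> ennreal \<epsilon>) \<longrightarrow>
       (\<exists>p. \<forall>\<epsilon>>0. \<exists>N. \<forall>i\<ge>N. riem_dist A (X i) p \<le> ennreal \<epsilon>))"
proof -
  have "(\<forall>\<epsilon>>0. \<exists>N. \<forall>i\<ge>N. \<forall>j\<ge>N. riem_dist A (X i) (X j) < \<epsilon>) \<longleftrightarrow>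
      (\<forall>\<epsilon>::real. \<epsilon> > 0 \<longrightarrow> (\<exists>N. \<forall>i\<ge>N. \<forall>j\<ge>N. riem_dist A (X i) (X j) \<le> ennreal \<epsilon>))" (is "?L \<longleftrightarrow> ?R") for X :: "nat \<Rightarrow> 'p"
  proof
    assume ?L
    then show ?R by (meson ennreal_less_zero_iff less_imp_le)
  next
    assume R: ?R
    show ?L
    proof (intro allI impI)
      fix a :: ennreal assume "0 < a"
      then obtain \<epsilon> where \<epsilon>: "0 < ennreal \<epsilon>" "ennreal \<epsilon> < a"
        by (metis dense ennreal_cases less_top_ennreal less_trans order_less_imp_not_less top_greatest not_less)
      with R obtain N where "\<forall>i\<ge>N. \<forall>j\<ge>N. riem_dist A (X i) (X j) \<le> ennreal \<epsilon>" by auto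
      then show "\<exists>N. \<forall>i\<ge>N. \<forall>j\<ge>N. riem_dist A (X i) (X j) < a"
        using \<epsilon> by (meson le_less_trans)
    qed
  qed
  then show ?thesis by (simp only: riem_complete_def ennreal_null_sequence_iff)
qed

section \<open>Speed and length of curves in a warped product\<close>

lemma chart_at_in:
  assumes "riemannian_manifold A"
  shows "chart_at A p \<in> A" "p \<in> chart_dom (chart_at A p)"
proof -
  have "\<exists>c. c \<in> A \<and> p \<in> chart_dom c" using assms by (auto simp: riemannian_manifold_def)
  from someI_ex[OF this] show "chart_at A p \<in> A" "p \<in> chart_dom (chart_at A p)"
    by (auto simp: chart_at_def)
qed

text \<open>By continuity the curve stays in the domain of \<open>c\<close> near \<open>s\<close>,
  so its expression in \<open>d\<close> is the transition map after its expression in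
  \<open>c\<close>; the chain rule and the transformation law of the metric do the rest. This
  matters because \<open>speed\<close> picks a chart at each point by choice.\<close>

lemma metric_velocity_invariant:
  assumes A: "riemannian_manifold A" and c: "c \<in> A" "\<gamma> s \<in> chart_dom c" and d: "d \<in> A" "\<gamma> s \<in> chart_dom d"
    and cont: "isCont \<gamma> s" and diff: "(chart_map c \<circ> \<gamma>) differentiable at s"
  shows "chart_metric c (chart_map c (\<gamma> s)) (vector_derivative (chart_map c \<circ> \<gamma>) (at s)) (vector_derivative (chart_map c \<circ> \<gamma>) (at s))
    = chart_metric d (chart_map d (\<gamma> s)) (vector_derivative (chart_map d \<circ> \<gamma>) (at s)) (vector_derivative (chart_map d \<circ> \<gamma>) (at s))"
proof -
  let ?T = "transition c d" and ?u = "vector_derivative (chart_map c \<circ> \<gamma>) (at s)"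
  let ?T' = "frechet_derivative ?T (at (chart_map c (\<gamma> s)))"
  have lc: "local_riemannian c" and comp: "compatible_charts c d"
    using A c d by (auto simp: riemannian_manifold_def)
  have "\<gamma> s \<in> chart_dom c \<inter> chart_dom d" using c d by auto
  then have "?T differentiable at (chart_map c (\<gamma> s))"
    using comp unfolding compatible_charts_def by (metis imageI smooth_onD_differentiable)
  then have T: "(?T has_derivative ?T') (at (chart_map c (\<gamma> s)))"
    by (simp add: frechet_derivative_works)
  have u: "((chart_map c \<circ> \<gamma>) has_derivative (\<lambda>h. h *\<^sub>R ?u)) (at s)"
    using diff by (simp add: vector_derivative_works has_vector_derivative_def)
  have "((\<lambda>r. ?T ((chart_map c \<circ> \<gamma>) r)) has_derivative (\<lambda>h. ?T' (h *\<^sub>R ?u))) (at s)"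
    using has_derivative_compose[OF u] T by simp
  moreover have "linear ?T'" using T has_derivative_linear by blast
  ultimately have v: "((\<lambda>r. ?T ((chart_map c \<circ> \<gamma>) r)) has_vector_derivative ?T' ?u) (at s)"
    by (simp add: has_vector_derivative_def linear_cmul)
  have "open (chart_dom c)" using lc by (simp add: local_riemannian_def)
  then have "\<forall>\<^sub>F r in at s. \<gamma> r \<in> chart_dom c"
    using cont c(2) topological_tendstoD unfolding isCont_def by blast
  then have "\<forall>\<^sub>F r in nhds s. \<gamma> r \<in> chart_dom c"
    using c(2) by (simp add: eventually_nhds_conv_at)
  then have ev: "\<forall>\<^sub>F r in nhds s. ?T ((chart_map c \<circ> \<gamma>) r) = (chart_map d \<circ> \<gamma>) r"
  proof eventually_elim
    case (elim r)
    then have "chart_inv c (chart_map c (\<gamma> r)) = \<gamma> r"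
      using lc by (simp add: local_riemannian_def homeomorphism_def)
    then show ?case by (simp add: transition_def)
  qed
  have "((\<lambda>r. ?T ((chart_map c \<circ> \<gamma>) r)) has_vector_derivative ?T' ?u) (at s) =
      ((chart_map d \<circ> \<gamma>) has_vector_derivative ?T' ?u) (at s)"
    using ev eventually_nhds_x_imp_x[OF ev] by (intro has_vector_derivative_cong_ev) auto
  with v have "((chart_map d \<circ> \<gamma>) has_vector_derivative ?T' ?u) (at s)" by simp
  then have "vector_derivative (chart_map d \<circ> \<gamma>) (at s) = ?T' ?u" by (rule vector_derivative_at)
  then show ?thesis using comp c d unfolding compatible_charts_def by simp
qed

lemma metric_nonneg:
  assumes "riemannian_manifold A" "c \<in> A" "x \<in> chart_image c"
  shows "chart_metric c x u u \<ge> 0"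
proof -
  interpret smooth_metric "chart_image c" "chart_metric c"
    using assms by (intro local_riemannian_imp_smooth_metric) (simp add: riemannian_manifold_def)
  show ?thesis
    using pos[OF assms(3), of u] bilinear_lzero[OF bil[OF assms(3)]] by (cases "u = 0") auto
qed

lemma warped_chart_simps [simp]:
  "chart_dom (warped_chart w c) = UNIV \<times> chart_dom c"
  "chart_map (warped_chart w c) = (\<lambda>(t, p). (t, chart_map c p))"
  "chart_metric (warped_chart w c) = warped_metric w (chart_metric c)"
  by (simp_all add: warped_chart_def warped_metric_def)

text \<open>The chart that \<open>speed\<close> selects on the product need not come from the one selected on the fibre.\<close>

lemma speed_warped:
  assumes A: "riemannian_manifold A" and cont: "isCont \<gamma> s"
    and \<tau>: "(\<lambda>r. fst (\<gamma> r)) differentiable at s"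
    and \<sigma>: "\<And>c. c \<in> A \<Longrightarrow> snd (\<gamma> s) \<in> chart_dom c \<Longrightarrow> (chart_map c \<circ> (\<lambda>r. snd (\<gamma> r))) differentiable at s"
  shows "speed (warped_product w A) \<gamma> s =
      sqrt ((vector_derivative (\<lambda>r. fst (\<gamma> r)) (at s))\<^sup>2 + (w (fst (\<gamma> s)) * speed A (\<lambda>r. snd (\<gamma> r)) s)\<^sup>2)"
    and "speed A (\<lambda>r. snd (\<gamma> r)) s \<ge> 0"
proof -
  let ?\<tau> = "\<lambda>r. fst (\<gamma> r)" and ?\<sigma> = "\<lambda>r. snd (\<gamma> r)"
  have "\<exists>d. d \<in> warped_product w A \<and> \<gamma> s \<in> chart_dom d"
    using chart_at_in[OF A, of "?\<sigma> s"]
    by (intro exI[of _ "warped_chart w (chart_at A (?\<sigma> s))"]) (auto simp: warped_product_def mem_Times_iff)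
  from someI_ex[OF this] have "chart_at (warped_product w A) (\<gamma> s) \<in> warped_product w A"
    "\<gamma> s \<in> chart_dom (chart_at (warped_product w A) (\<gamma> s))"
    by (auto simp: chart_at_def)
  then obtain c where c: "chart_at (warped_product w A) (\<gamma> s) = warped_chart w c" "c \<in> A" "?\<sigma> s \<in> chart_dom c"
    by (auto simp: warped_product_def)
  let ?c = "chart_at A (?\<sigma> s)"
  let ?u = "vector_derivative (chart_map c \<circ> ?\<sigma>) (at s)"
  have "chart_map (warped_chart w c) \<circ> \<gamma> = (\<lambda>r. (?\<tau> r, (chart_map c \<circ> ?\<sigma>) r))"
    by (auto simp: fun_eq_iff split: prod.splits)
  moreover have "((\<lambda>r. (?\<tau> r, (chart_map c \<circ> ?\<sigma>) r)) has_vector_derivative (vector_derivative ?\<tau> (at s), ?u)) (at s)"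
    using \<tau> \<sigma>[OF c(2,3)] by (intro has_vector_derivative_Pair) (simp_all only: vector_derivative_works[symmetric])
  ultimately have vd: "vector_derivative (chart_map (warped_chart w c) \<circ> \<gamma>) (at s) = (vector_derivative ?\<tau> (at s), ?u)"
    by (metis vector_derivative_at)
  have cs: "isCont ?\<sigma> s" using cont by (intro continuous_intros)
  have nn: "chart_metric c (chart_map c (?\<sigma> s)) ?u ?u \<ge> 0"
    using metric_nonneg[OF A c(2)] c(3) by (simp add: chart_image_def)
  have "speed A ?\<sigma> s = sqrt (chart_metric c (chart_map c (?\<sigma> s)) ?u ?u)"
    unfolding speed_def Let_def
    using metric_velocity_invariant[where \<gamma> = ?\<sigma>, OF A c(2,3) chart_at_in[OF A] cs \<sigma>[OF c(2,3)]] by simp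
  moreover from this nn show "speed A ?\<sigma> s \<ge> 0" by simp
  ultimately have sq: "chart_metric c (chart_map c (?\<sigma> s)) ?u ?u = (speed A ?\<sigma> s)\<^sup>2" using nn by simp
  show "speed (warped_product w A) \<gamma> s =
      sqrt ((vector_derivative ?\<tau> (at s))\<^sup>2 + (w (?\<tau> s) * speed A ?\<sigma> s)\<^sup>2)"
    unfolding speed_def[of "warped_product w A"] Let_def c(1) vd
    by (cases "\<gamma> s") (use sq in \<open>simp add: power2_eq_square mult_ac\<close>)
qed

lemma C1_differentiable_on_snd:
  assumes "(\<lambda>s. (f s, g s)) C1_differentiable_on S"
  shows "g C1_differentiable_on S"
proof -
  obtain D where D: "\<And>s. s \<in> S \<Longrightarrow> ((\<lambda>s. (f s, g s)) has_vector_derivative D s) (at s)" "continuous_on S D"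
    using assms by (auto simp: C1_differentiable_on_def)
  have "(g has_vector_derivative snd (D s)) (at s)" if "s \<in> S" for s
    using bounded_linear.has_vector_derivative[OF bounded_linear_snd D(1)[OF that]] by simp
  moreover have "continuous_on S (\<lambda>s. snd (D s))" using D(2) by (intro continuous_intros)
  ultimately show ?thesis
    unfolding C1_differentiable_on_def by (intro exI[of _ "\<lambda>s. snd (D s)"]) auto
qed

lemma C1_differentiable_on_Pair:
  assumes "f C1_differentiable_on S" "g C1_differentiable_on S"
  shows "(\<lambda>s. (f s, g s)) C1_differentiable_on S"
proof -
  obtain D D' where D: "\<And>s. s \<in> S \<Longrightarrow> (f has_vector_derivative D s) (at s)" "continuous_on S D"
    "\<And>s. s \<in> S \<Longrightarrow> (g has_vector_derivative D' s) (at s)" "continuous_on S D'"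
    using assms unfolding C1_differentiable_on_def by metis
  have "((\<lambda>s. (f s, g s)) has_vector_derivative (D s, D' s)) (at s)" if "s \<in> S" for s
    by (intro has_vector_derivative_Pair D that)
  moreover have "continuous_on S (\<lambda>s. (D s, D' s))" by (intro continuous_intros D)
  ultimately show ?thesis
    unfolding C1_differentiable_on_def by (intro exI[of _ "\<lambda>s. (D s, D' s)"]) auto
qed

lemma piecewise_C1_curve_warpedE:
  assumes A: "riemannian_manifold A" and \<gamma>: "piecewise_C1_curve (warped_product w A) \<gamma>"
  obtains N where "finite N" "piecewise_C1_curve A (\<lambda>s. snd (\<gamma> s))"
    "\<And>s. s \<in> {0<..<1} - N \<Longrightarrow> (\<lambda>s. fst (\<gamma> s)) differentiable at s"
    "\<And>s c. s \<in> {0<..<1} - N \<Longrightarrow> c \<in> A \<Longrightarrow> snd (\<gamma> s) \<in> chart_dom c \<Longrightarrow>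
       (chart_map c \<circ> (\<lambda>s. snd (\<gamma> s))) differentiable at s"
proof -
  let ?S = "\<lambda>c. {s \<in> {0<..<1}. snd (\<gamma> s) \<in> chart_dom c}"
  have cont: "continuous_on {0..1} \<gamma>" using \<gamma> by (simp add: piecewise_C1_curve_def)
  obtain N where N: "finite N" "\<And>c. c \<in> A \<Longrightarrow>
      (chart_map (warped_chart w c) \<circ> \<gamma>) C1_differentiable_on ({s\<in>{0<..<1}. \<gamma> s \<in> chart_dom (warped_chart w c)} - N)"
    using \<gamma> by (auto simp: piecewise_C1_curve_def warped_product_def)
  have eq: "chart_map (warped_chart w c) \<circ> \<gamma> = (\<lambda>s. (fst (\<gamma> s), (chart_map c \<circ> (\<lambda>s. snd (\<gamma> s))) s))" for c
    by (auto simp: fun_eq_iff split: prod.splits)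
  have pair: "(\<lambda>s. (fst (\<gamma> s), (chart_map c \<circ> (\<lambda>s. snd (\<gamma> s))) s)) C1_differentiable_on (?S c - N)" if "c \<in> A" for c
    using N(2)[OF that] unfolding eq by (simp add: mem_Times_iff)
  have C1: "(chart_map c \<circ> (\<lambda>s. snd (\<gamma> s))) C1_differentiable_on (?S c - N)" if "c \<in> A" for c
    using C1_differentiable_on_snd[OF pair[OF that]] .
  have "continuous_on {0..1} (\<lambda>s. snd (\<gamma> s))" using cont by (intro continuous_intros)
  then have p1: "piecewise_C1_curve A (\<lambda>s. snd (\<gamma> s))"
    unfolding piecewise_C1_curve_def using N(1) C1 by blast
  have p2: "(\<lambda>s. fst (\<gamma> s)) differentiable at s" if s: "s \<in> {0<..<1} - N" for s
  proof -
    let ?c = "chart_at A (snd (\<gamma> s))"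
    have c: "?c \<in> A" "s \<in> ?S ?c - N" using chart_at_in[OF A] s by auto
    then obtain D where "((\<lambda>s. (fst (\<gamma> s), (chart_map ?c \<circ> (\<lambda>s. snd (\<gamma> s))) s)) has_vector_derivative D) (at s)"
      using pair[OF c(1)] unfolding C1_differentiable_on_def by blast
    from bounded_linear.has_vector_derivative[OF bounded_linear_fst this]
    have "((\<lambda>s. fst (\<gamma> s)) has_vector_derivative fst D) (at s)" by simp
    then show ?thesis by (rule differentiableI_vector)
  qed
  have p3: "(chart_map c \<circ> (\<lambda>s. snd (\<gamma> s))) differentiable at s"
    if s: "s \<in> {0<..<1} - N" and c: "c \<in> A" and "snd (\<gamma> s) \<in> chart_dom c" for s c
  proof -
    have "s \<in> ?S c - N" using that by auto
    then obtain D where "((chart_map c \<circ> (\<lambda>s. snd (\<gamma> s))) has_vector_derivative D) (at s)"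
      using C1[OF c] unfolding C1_differentiable_on_def by blast
    then show ?thesis by (rule differentiableI_vector)
  qed
  show thesis by (rule that[OF N(1) p1 p2 p3])
qed

lemma isCont_unit_interior:
  assumes "continuous_on {0..1} \<gamma>" "s \<in> {0<..<1::real}"
  shows "isCont \<gamma> s"
  using continuous_on_interior[OF assms(1), of s] assms(2) by simp

text \<open>Each bound drops one term under the square root of the speed. The displacement is
  bounded at every parameter \<open>b\<close>, not only at the end, to confine a short curve to an
  interval on which \<open>w\<close> is bounded below.\<close>

lemma warped_curve_length_bounds:
  assumes A: "riemannian_manifold A" and \<gamma>: "piecewise_C1_curve (warped_product w A) \<gamma>"
  shows "b \<in> {0..1} \<Longrightarrow> ennreal \<bar>fst (\<gamma> b) - fst (\<gamma> 0)\<bar> \<le> curve_length (warped_product w A) \<gamma>"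
    and "m > 0 \<Longrightarrow> (\<And>s. s \<in> {0..1} \<Longrightarrow> m \<le> w (fst (\<gamma> s))) \<Longrightarrow>
      curve_length A (\<lambda>s. snd (\<gamma> s)) \<le> ennreal (1 / m) * curve_length (warped_product w A) \<gamma>"
proof -
  obtain N where N: "finite N"
    "\<And>s. s \<in> {0<..<1} - N \<Longrightarrow> (\<lambda>s. fst (\<gamma> s)) differentiable at s"
    "\<And>s c. s \<in> {0<..<1} - N \<Longrightarrow> c \<in> A \<Longrightarrow> snd (\<gamma> s) \<in> chart_dom c \<Longrightarrow>
       (chart_map c \<circ> (\<lambda>s. snd (\<gamma> s))) differentiable at s"
    using piecewise_C1_curve_warpedE[OF A \<gamma>] by metis
  have cont: "continuous_on {0..1} \<gamma>" using \<gamma> by (simp add: piecewise_C1_curve_def)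
  have sp: "speed (warped_product w A) \<gamma> s =
      sqrt ((vector_derivative (\<lambda>r. fst (\<gamma> r)) (at s))\<^sup>2 + (w (fst (\<gamma> s)) * speed A (\<lambda>r. snd (\<gamma> r)) s)\<^sup>2)"
    "speed A (\<lambda>r. snd (\<gamma> r)) s \<ge> 0" if s: "s \<in> {0<..<1} - N" for s
  proof -
    have "isCont \<gamma> s" using s by (intro isCont_unit_interior[OF cont]) auto
    from speed_warped[OF A this N(2)[OF s] N(3)[OF s]]
    show "speed (warped_product w A) \<gamma> s =
      sqrt ((vector_derivative (\<lambda>r. fst (\<gamma> r)) (at s))\<^sup>2 + (w (fst (\<gamma> s)) * speed A (\<lambda>r. snd (\<gamma> r)) s)\<^sup>2)"
      "speed A (\<lambda>r. snd (\<gamma> r)) s \<ge> 0" by auto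
  qed
  have sp0: "speed (warped_product w A) \<gamma> s \<ge> 0" if "s \<in> {0<..<1} - N" for s
    using sp(1)[OF that] by simp
  {
    assume "b \<in> {0..1}"
    have "ennreal \<bar>fst (\<gamma> b) - fst (\<gamma> 0)\<bar>
        \<le> (\<integral>\<^sup>+s\<in>{0..1}. ennreal \<bar>vector_derivative (\<lambda>s. fst (\<gamma> s)) (at s)\<bar> \<partial>lborel)"
      by (rule displacement_le_integral[OF _ N(1)]) (use N \<open>b \<in> {0..1}\<close> cont in \<open>auto intro!: continuous_intros\<close>)
    also have "\<dots> \<le> ennreal 0 + ennreal 1 * (\<integral>\<^sup>+s\<in>{0..1}. ennreal (speed (warped_product w A) \<gamma> s) \<partial>lborel)"
      by (rule interval_integral_affine_le[OF N(1)]) (auto simp: sp)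
    finally show "ennreal \<bar>fst (\<gamma> b) - fst (\<gamma> 0)\<bar> \<le> curve_length (warped_product w A) \<gamma>"
      by (simp add: curve_length_def)
  }
  {
    assume m: "m > 0" "\<And>s. s \<in> {0..1} \<Longrightarrow> m \<le> w (fst (\<gamma> s))"
    have "speed A (\<lambda>s. snd (\<gamma> s)) s \<le> 0 + (1 / m) * speed (warped_product w A) \<gamma> s"
      if s: "s \<in> {0<..<1} - N" for s
    proof -
      have "m * speed A (\<lambda>s. snd (\<gamma> s)) s \<le> w (fst (\<gamma> s)) * speed A (\<lambda>s. snd (\<gamma> s)) s"
        using sp(2)[OF s] m(2)[of s] s by (intro mult_right_mono) auto
      also have "\<dots> \<le> speed (warped_product w A) \<gamma> s"
        unfolding sp(1)[OF s] by (rule real_sqrt_sum_squares_ge2)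
      finally show ?thesis using m(1) by (simp add: field_simps)
    qed
    from interval_integral_affine_le[OF N(1) _ _ this sp0] m(1)
    show "curve_length A (\<lambda>s. snd (\<gamma> s)) \<le> ennreal (1 / m) * curve_length (warped_product w A) \<gamma>"
      by (simp add: curve_length_def)
  }
qed

section \<open>Distances in the product against those in its factors\<close>

lemma riem_dist_fst_le:
  assumes "riemannian_manifold A"
  shows "ennreal \<bar>t' - t\<bar> \<le> riem_dist (warped_product w A) (t, p) (t', p')"
  unfolding riem_dist_def
proof (rule INF_greatest, clarify)
  fix \<gamma> assume "piecewise_C1_curve (warped_product w A) \<gamma>" "\<gamma> 0 = (t, p)" "\<gamma> 1 = (t', p')"
  then show "ennreal \<bar>t' - t\<bar> \<le> curve_length (warped_product w A) \<gamma>"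
    using warped_curve_length_bounds(1)[OF assms, of w \<gamma> 1] by simp
qed

text \<open>A curve of length less than \<epsilon> cannot leave the \<epsilon>-interval around t, so
  a lower bound of \<open>w\<close> there suffices. The strict bound on the distance yields an
  actual curve, as the infimum need not be attained.\<close>

lemma riem_dist_snd_le:
  assumes A: "riemannian_manifold A" and m: "m > 0" "\<And>s. \<bar>s - t\<bar> \<le> \<epsilon> \<Longrightarrow> m \<le> w s" and \<epsilon>: "\<epsilon> > 0"
    and d: "riem_dist (warped_product w A) (t, p) (t', p') < ennreal \<epsilon>"
  shows "riem_dist A p p' \<le> ennreal (\<epsilon> / m)"
proof -
  obtain \<gamma> where \<gamma>: "piecewise_C1_curve (warped_product w A) \<gamma>" "\<gamma> 0 = (t, p)" "\<gamma> 1 = (t', p')"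
    and len: "curve_length (warped_product w A) \<gamma> < ennreal \<epsilon>"
    using d unfolding riem_dist_def by (auto simp: INF_less_iff)
  have "m \<le> w (fst (\<gamma> s))" if "s \<in> {0..1}" for s
  proof -
    have "ennreal \<bar>fst (\<gamma> s) - fst (\<gamma> 0)\<bar> < ennreal \<epsilon>"
      using warped_curve_length_bounds(1)[OF A \<gamma>(1) that] len by (rule le_less_trans)
    then have "\<bar>fst (\<gamma> s) - t\<bar> < \<epsilon>" using \<gamma>(2) by (simp add: ennreal_less_iff)
    then show ?thesis using m(2) by simp
  qed
  from warped_curve_length_bounds(2)[OF A \<gamma>(1) m(1) this]
  have "curve_length A (\<lambda>s. snd (\<gamma> s)) \<le> ennreal (1 / m) * ennreal \<epsilon>"
    using len by (meson less_imp_le mult_left_mono order_trans zero_le)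
  also have "\<dots> = ennreal (\<epsilon> / m)" using m(1) \<epsilon> by (simp add: ennreal_mult[symmetric])
  finally have "curve_length A (\<lambda>s. snd (\<gamma> s)) \<le> ennreal (\<epsilon> / m)" .
  moreover have "piecewise_C1_curve A (\<lambda>s. snd (\<gamma> s))"
    using piecewise_C1_curve_warpedE[OF A \<gamma>(1)] by blast
  ultimately show ?thesis
    unfolding riem_dist_def using \<gamma> by (intro INF_lower2[of "\<lambda>s. snd (\<gamma> s)"]) auto
qed

text \<open>A fibre curve is lifted by running the affine path from t to t' on the same parameter;
  the square root of a sum of squares is at most the sum of the absolute values.\<close>

lemma riem_dist_warped_le:
  assumes A: "riemannian_manifold A" and W: "W > 0" "\<And>s. s \<in> closed_segment t t' \<Longrightarrow> \<bar>w s\<bar> \<le> W" and \<epsilon>: "\<epsilon> > 0"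
    and d: "riem_dist A p p' < ennreal \<epsilon>"
  shows "riem_dist (warped_product w A) (t, p) (t', p') \<le> ennreal (\<bar>t' - t\<bar> + W * \<epsilon>)"
proof -
  obtain \<sigma> where \<sigma>: "piecewise_C1_curve A \<sigma>" "\<sigma> 0 = p" "\<sigma> 1 = p'"
    and len: "curve_length A \<sigma> < ennreal \<epsilon>"
    using d unfolding riem_dist_def by (auto simp: INF_less_iff)
  define \<tau> where "\<tau> s = (1 - s) * t + s * t'" for s
  define \<gamma> where "\<gamma> s = (\<tau> s, \<sigma> s)" for s
  have \<tau>': "(\<tau> has_vector_derivative (t' - t)) (at s)" for s
    unfolding has_real_derivative_iff_has_vector_derivative[symmetric] \<tau>_def[abs_def]
    by (auto intro!: derivative_eq_intros simp: algebra_simps)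
  have \<tau>C1: "\<tau> C1_differentiable_on S" for S
    unfolding C1_differentiable_on_def using \<tau>' by (intro exI[of _ "\<lambda>_. t' - t"]) auto
  have cont: "continuous_on {0..1} \<gamma>"
    using \<sigma>(1) unfolding \<gamma>_def[abs_def] \<tau>_def[abs_def]
    by (intro continuous_intros) (simp add: piecewise_C1_curve_def)
  obtain N where N: "finite N" "\<And>c. c \<in> A \<Longrightarrow>
      (chart_map c \<circ> \<sigma>) C1_differentiable_on ({s\<in>{0<..<1}. \<sigma> s \<in> chart_dom c} - N)"
    using \<sigma>(1) by (auto simp: piecewise_C1_curve_def)
  have eq: "chart_map (warped_chart w c) \<circ> \<gamma> = (\<lambda>s. (\<tau> s, (chart_map c \<circ> \<sigma>) s))" for c
    by (auto simp: fun_eq_iff \<gamma>_def)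
  have "(chart_map (warped_chart w c) \<circ> \<gamma>) C1_differentiable_on
      ({s\<in>{0<..<1}. \<gamma> s \<in> chart_dom (warped_chart w c)} - N)" if "c \<in> A" for c
    using C1_differentiable_on_Pair[OF \<tau>C1 N(2)[OF that]] unfolding eq by (simp add: \<gamma>_def)
  then have pw: "piecewise_C1_curve (warped_product w A) \<gamma>"
    unfolding piecewise_C1_curve_def using cont N(1) by (auto simp: warped_product_def)
  have sp: "speed (warped_product w A) \<gamma> s \<le> \<bar>t' - t\<bar> + W * speed A \<sigma> s" "speed A \<sigma> s \<ge> 0"
    if s: "s \<in> {0<..<1} - N" for s
  proof -
    have "isCont \<gamma> s" using s by (intro isCont_unit_interior[OF cont]) auto
    moreover have "(chart_map c \<circ> \<sigma>) differentiable at s" if "c \<in> A" "\<sigma> s \<in> chart_dom c" for c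
    proof -
      have "s \<in> {s\<in>{0<..<1}. \<sigma> s \<in> chart_dom c} - N" using that s by auto
      then show ?thesis
        using N(2)[OF that(1)] unfolding C1_differentiable_on_def by (metis differentiableI_vector)
    qed
    moreover have "\<tau> differentiable at s" using \<tau>' by (rule differentiableI_vector)
    ultimately have eq: "speed (warped_product w A) \<gamma> s
        = sqrt ((vector_derivative \<tau> (at s))\<^sup>2 + (w (\<tau> s) * speed A \<sigma> s)\<^sup>2)" and nn: "speed A \<sigma> s \<ge> 0"
      using speed_warped(1)[OF A, where \<gamma> = \<gamma> and s = s and w = w]
        speed_warped(2)[OF A, where \<gamma> = \<gamma> and s = s] by (simp_all add: \<gamma>_def)
    show "speed A \<sigma> s \<ge> 0" by (rule nn)
    have "\<tau> s \<in> closed_segment t t'"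
      using s by (auto simp: closed_segment_def \<tau>_def intro!: exI[of _ s])
    then have "\<bar>w (\<tau> s)\<bar> * speed A \<sigma> s \<le> W * speed A \<sigma> s"
      using nn W by (intro mult_right_mono) auto
    moreover have "speed (warped_product w A) \<gamma> s \<le> \<bar>t' - t\<bar> + \<bar>w (\<tau> s) * speed A \<sigma> s\<bar>"
      unfolding eq vector_derivative_at[OF \<tau>'] by (rule sqrt_sum_squares_le_sum_abs)
    ultimately show "speed (warped_product w A) \<gamma> s \<le> \<bar>t' - t\<bar> + W * speed A \<sigma> s"
      using nn by (simp add: abs_mult)
  qed
  have "curve_length (warped_product w A) \<gamma> \<le> ennreal \<bar>t' - t\<bar> + ennreal W * curve_length A \<sigma>"
    unfolding curve_length_def by (rule interval_integral_affine_le[OF N(1) _ W(1) sp]) auto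
  also have "\<dots> \<le> ennreal \<bar>t' - t\<bar> + ennreal W * ennreal \<epsilon>"
    using len by (intro add_left_mono mult_left_mono) auto
  also have "\<dots> = ennreal (\<bar>t' - t\<bar> + W * \<epsilon>)" using W(1) \<epsilon> by (simp add: ennreal_mult ennreal_plus)
  finally show ?thesis
    unfolding riem_dist_def using pw \<sigma> by (intro INF_lower2[of \<gamma>]) (auto simp: \<gamma>_def \<tau>_def)
qed

text \<open>Mediates between the non-strict bounds of \<open>riem_complete_iff\<close> and the
  strict ones that the distance comparisons need; hence the halved tolerances below.\<close>

lemma le_half_imp_less:
  fixes \<delta> :: real
  assumes "x \<le> ennreal (\<delta> / 2)" "\<delta> > 0"
  shows "x < ennreal \<delta>"
proof -
  have "ennreal (\<delta> / 2) < ennreal \<delta>" using assms(2) by (simp add: ennreal_less_iff)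
  with assms(1) show ?thesis by (rule le_less_trans)
qed

text \<open>The sequence is placed in the slice t = 0, where lifting costs the factor
  \<open>w 0\<close>. The limit in the product may lie over any t, but only its fibre component is
  used, and curves from t = 0 shorter than 1 stay where \<open>w\<close> is at least its minimum
  over [-1,1].\<close>

lemma riem_complete_fibre:
  fixes A :: "('p::{t2_space, second_countable_topology}, 'e::euclidean_space) rchart set"
  assumes A: "riemannian_manifold A" and w: "continuous_on UNIV w" "\<And>t. w t > 0"
    and complete: "riem_complete (warped_product w A)"
  shows "riem_complete A"
  unfolding riem_complete_iff
proof (intro allI impI)
  fix X :: "nat \<Rightarrow> 'p" assume X: "\<forall>\<epsilon>>0. \<exists>N. \<forall>i\<ge>N. \<forall>j\<ge>N. riem_dist A (X i) (X j) \<le> ennreal \<epsilon>"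
  have "\<forall>\<epsilon>>0. \<exists>N. \<forall>i\<ge>N. \<forall>j\<ge>N. riem_dist (warped_product w A) (0, X i) (0, X j) \<le> ennreal \<epsilon>"
  proof (intro allI impI)
    fix \<epsilon> :: real assume \<epsilon>: "\<epsilon> > 0"
    define \<delta> where "\<delta> = \<epsilon> / w 0"
    have \<delta>: "\<delta> > 0" using \<epsilon> w(2)[of 0] by (simp add: \<delta>_def)
    then obtain N where N: "\<forall>i\<ge>N. \<forall>j\<ge>N. riem_dist A (X i) (X j) \<le> ennreal (\<delta> / 2)"
      using X by (meson half_gt_zero)
    have "riem_dist (warped_product w A) (0, X i) (0, X j) \<le> ennreal \<epsilon>" if "i \<ge> N" "j \<ge> N" for i j
    proof -
      have "riem_dist A (X i) (X j) < ennreal \<delta>"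
        using N that \<delta> by (intro le_half_imp_less) auto
      from riem_dist_warped_le[OF A w(2)[of 0] _ \<delta> this, where t = 0 and t' = 0 and w = w] w(2)[of 0]
      show ?thesis by (simp add: \<delta>_def)
    qed
    then show "\<exists>N. \<forall>i\<ge>N. \<forall>j\<ge>N. riem_dist (warped_product w A) (0, X i) (0, X j) \<le> ennreal \<epsilon>" by blast
  qed
  with complete[unfolded riem_complete_iff, rule_format, of "\<lambda>i. (0, X i)"]
  obtain q where "\<forall>\<epsilon>>0. \<exists>N. \<forall>i\<ge>N. riem_dist (warped_product w A) (0, X i) q \<le> ennreal \<epsilon>" by auto
  then obtain t p where tp: "\<forall>\<epsilon>>0. \<exists>N. \<forall>i\<ge>N. riem_dist (warped_product w A) (0, X i) (t, p) \<le> ennreal \<epsilon>"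
    by (cases q) blast
  obtain s0 where "\<forall>s\<in>{-1..1}. w s0 \<le> w s"
    using continuous_attains_inf[of "{-1..1::real}" w] continuous_on_subset[OF w(1)] by auto
  then obtain m where m: "m > 0" "\<And>s. \<bar>s\<bar> \<le> 1 \<Longrightarrow> m \<le> w s"
    using w(2)[of s0] by (metis abs_le_iff atLeastAtMost_iff minus_le_iff)
  have "\<exists>N. \<forall>i\<ge>N. riem_dist A (X i) p \<le> ennreal \<epsilon>" if \<epsilon>: "\<epsilon> > 0" for \<epsilon>
  proof -
    \<comment> \<open>The bound 1 keeps the curves over [-1,1]; the bound m \<epsilon> makes the
      projected length at most \<epsilon>.\<close>
    define \<eta> where "\<eta> = min 1 (m * \<epsilon>)"
    have \<eta>: "\<eta> > 0" "\<eta> \<le> 1" "\<eta> / m \<le> \<epsilon>" using \<epsilon> m(1) by (auto simp: \<eta>_def field_simps)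
    then obtain N where N: "\<forall>i\<ge>N. riem_dist (warped_product w A) (0, X i) (t, p) \<le> ennreal (\<eta> / 2)"
      using tp by (meson half_gt_zero)
    have "riem_dist A (X i) p \<le> ennreal \<epsilon>" if "i \<ge> N" for i
    proof -
      have "riem_dist (warped_product w A) (0, X i) (t, p) < ennreal \<eta>"
        using N that \<eta> by (intro le_half_imp_less) auto
      then have "riem_dist A (X i) p \<le> ennreal (\<eta> / m)"
        by (rule riem_dist_snd_le[OF A m(1) _ \<eta>(1), rotated]) (use m(2) \<eta>(2) in auto)
      then show ?thesis using \<eta>(3) by (meson ennreal_leI order_trans)
    qed
    then show ?thesis by blast
  qed
  then show "\<exists>p. \<forall>\<epsilon>>0. \<exists>N. \<forall>i\<ge>N. riem_dist A (X i) p \<le> ennreal \<epsilon>" by blast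
qed

text \<open>Projection makes both components Cauchy. Returning from the two limits takes an upper
  bound of \<open>w\<close>, since lifting a fibre curve stretches it: this is the maximum of
  \<open>w\<close> over a unit neighbourhood of the limit on the line.\<close>

lemma riem_complete_warped_product:
  fixes A :: "('p::{t2_space, second_countable_topology}, 'e::euclidean_space) rchart set"
  assumes A: "riemannian_manifold A" and w: "continuous_on UNIV w" and m: "m > 0" "\<And>t. m \<le> w t"
    and complete: "riem_complete A"
  shows "riem_complete (warped_product w A)"
  unfolding riem_complete_iff
proof (intro allI impI)
  fix Y :: "nat \<Rightarrow> real \<times> 'p"
  assume Y: "\<forall>\<epsilon>>0. \<exists>N. \<forall>i\<ge>N. \<forall>j\<ge>N. riem_dist (warped_product w A) (Y i) (Y j) \<le> ennreal \<epsilon>"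
  define \<tau> where "\<tau> i = fst (Y i)" for i
  define X where "X i = snd (Y i)" for i
  have Y_eq: "Y i = (\<tau> i, X i)" for i by (simp add: \<tau>_def X_def)
  have "Cauchy \<tau>"
  proof (rule metric_CauchyI)
    fix \<epsilon> :: real assume \<epsilon>: "\<epsilon> > 0"
    then obtain N where N: "\<forall>i\<ge>N. \<forall>j\<ge>N. riem_dist (warped_product w A) (Y i) (Y j) \<le> ennreal (\<epsilon> / 2)"
      using Y by (meson half_gt_zero)
    have "dist (\<tau> i) (\<tau> j) < \<epsilon>" if "i \<ge> N" "j \<ge> N" for i j
    proof -
      have "ennreal \<bar>\<tau> j - \<tau> i\<bar> \<le> ennreal (\<epsilon> / 2)"
        using riem_dist_fst_le[OF A, of "\<tau> j" "\<tau> i" w "X i" "X j"] N that by (metis Y_eq order_trans)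
      then show ?thesis
        using \<epsilon> abs_minus_commute[of "\<tau> i" "\<tau> j"] by (simp add: ennreal_le_iff dist_real_def)
    qed
    then show "\<exists>N. \<forall>i\<ge>N. \<forall>j\<ge>N. dist (\<tau> i) (\<tau> j) < \<epsilon>" by blast
  qed
  then obtain t where t: "\<tau> \<longlonglongrightarrow> t" using real_Cauchy_convergent convergent_def by blast
  have "\<forall>\<epsilon>>0. \<exists>N. \<forall>i\<ge>N. \<forall>j\<ge>N. riem_dist A (X i) (X j) \<le> ennreal \<epsilon>"
  proof (intro allI impI)
    fix \<epsilon> :: real assume \<epsilon>: "\<epsilon> > 0"
    then have \<delta>: "m * \<epsilon> > 0" using m(1) by simp
    then obtain N where N: "\<forall>i\<ge>N. \<forall>j\<ge>N. riem_dist (warped_product w A) (Y i) (Y j) \<le> ennreal (m * \<epsilon> / 2)"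
      using Y by (meson half_gt_zero)
    have "riem_dist A (X i) (X j) \<le> ennreal \<epsilon>" if "i \<ge> N" "j \<ge> N" for i j
    proof -
      have "riem_dist (warped_product w A) (\<tau> i, X i) (\<tau> j, X j) < ennreal (m * \<epsilon>)"
        unfolding Y_eq[symmetric] using N that \<delta> by (intro le_half_imp_less) auto
      from riem_dist_snd_le[OF A m(1) _ \<delta> this] show ?thesis using m by simp
    qed
    then show "\<exists>N. \<forall>i\<ge>N. \<forall>j\<ge>N. riem_dist A (X i) (X j) \<le> ennreal \<epsilon>" by blast
  qed
  with complete[unfolded riem_complete_iff, rule_format, of X]
  obtain p where p: "\<forall>\<epsilon>>0. \<exists>N. \<forall>i\<ge>N. riem_dist A (X i) p \<le> ennreal \<epsilon>" by auto
  obtain s0 where s0: "\<forall>s\<in>{t - 1..t + 1}. w s \<le> w s0"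
    using continuous_attains_sup[of "{t - 1..t + 1}" w] continuous_on_subset[OF w] by auto
  have W: "w s0 > 0" using m by (meson less_le_trans)
  have bound: "\<bar>w s\<bar> \<le> w s0" if "\<bar>r - t\<bar> < 1" "s \<in> closed_segment r t" for r s
  proof -
    have "s \<in> {t - 1..t + 1}" using that by (auto simp: closed_segment_eq_real_ivl split: if_splits)
    moreover have "w s > 0" using m by (meson less_le_trans)
    ultimately show ?thesis using s0 by auto
  qed
  have "\<exists>N. \<forall>i\<ge>N. riem_dist (warped_product w A) (Y i) (t, p) \<le> ennreal \<epsilon>" if \<epsilon>: "\<epsilon> > 0" for \<epsilon>
  proof -
    define \<delta> where "\<delta> = \<epsilon> / (2 * w s0)"
    have \<delta>: "\<delta> > 0" "w s0 * \<delta> = \<epsilon> / 2" using \<epsilon> W by (simp_all add: \<delta>_def)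
    obtain N1 where N1: "\<forall>i\<ge>N1. riem_dist A (X i) p \<le> ennreal (\<delta> / 2)"
      using p \<delta> by (meson half_gt_zero)
    obtain N2 where N2: "\<forall>i\<ge>N2. dist (\<tau> i) t < min 1 (\<epsilon> / 2)"
      using metric_LIMSEQ_D[OF t, of "min 1 (\<epsilon> / 2)"] \<epsilon> by auto
    have "riem_dist (warped_product w A) (Y i) (t, p) \<le> ennreal \<epsilon>" if "i \<ge> max N1 N2" for i
    proof -
      have i: "\<bar>\<tau> i - t\<bar> < 1" "\<bar>t - \<tau> i\<bar> < \<epsilon> / 2"
        using N2 that by (auto simp: dist_real_def abs_minus_commute)
      have "riem_dist A (X i) p < ennreal \<delta>"
        using N1 that \<delta> by (intro le_half_imp_less) auto
      from riem_dist_warped_le[OF A W bound[OF i(1)] \<delta>(1) this]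
      have "riem_dist (warped_product w A) (Y i) (t, p) \<le> ennreal (\<bar>t - \<tau> i\<bar> + w s0 * \<delta>)"
        by (simp add: Y_eq)
      also have "\<dots> \<le> ennreal \<epsilon>" using i \<delta> by (intro ennreal_leI) auto
      finally show ?thesis .
    qed
    then show ?thesis by blast
  qed
  then show "\<exists>q. \<forall>\<epsilon>>0. \<exists>N. \<forall>i\<ge>N. riem_dist (warped_product w A) (Y i) q \<le> ennreal \<epsilon>" by blast
qed

section \<open>The differential equations\<close>

lemma has_derivative_power_pred:
  fixes w :: "real \<Rightarrow> real"
  assumes "n \<ge> 3" "(w has_real_derivative d) (at t)"
  shows "((\<lambda>t. w t ^ (n - 1)) has_real_derivative (real n - 1) * w t ^ (n - 2) * d) (at t)"
  using DERIV_power[OF assms(2), of "n - 1"] assms(1)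
  by (simp add: of_nat_diff numeral_2_eq_2 mult_ac)

lemma power_pred:
  assumes "n \<ge> (3::nat)"
  shows "(x::real) ^ (n - 1) = x * x ^ (n - 2)"
  using assms power_Suc[of x "n - 2"] by (simp add: Suc_diff_le numeral_2_eq_2 numeral_3_eq_3 Suc_diff_Suc)

text \<open>The constants \<open>C\<close> and \<open>D\<close> are the first integrals \<open>\<phi> w\<^bsup>n-1\<^esup>\<close> and \<open>w'/w - B w\<^bsup>1-n\<^esup>\<close>.\<close>

lemma soliton_ode_first_order:
  fixes n :: nat and w w1 w2 \<phi> \<phi>1 :: "real \<Rightarrow> real"
  assumes n: "n \<ge> 3"
    and w1: "\<And>t. (w has_real_derivative w1 t) (at t)"
    and w2: "\<And>t. (w1 has_real_derivative w2 t) (at t)"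
    and \<phi>1: "\<And>t. (\<phi> has_real_derivative \<phi>1 t) (at t)"
    and pos: "\<And>t. w t > 0"
    and ode1: "\<And>t. \<phi>1 t + (real n - 1) * \<phi> t * w1 t / w t = 0"
    and ode2: "\<And>t. (real n - 2) * (w2 t / w t - (w1 t / w t)\<^sup>2) + real n * \<phi> t * (w1 t / w t) = 0"
  obtains B C D where "B = real n * C / ((real n - 1) * (real n - 2))"
    "\<And>t. \<phi> t = C / w t ^ (n - 1)" "\<And>t. w1 t = D * w t + B * w t / w t ^ (n - 1)"
proof -
  have w0: "w t \<noteq> 0" for t using pos[of t] by simp
  note wp = has_derivative_power_pred[OF n w1] and pw = power_pred[OF n]
  have "((\<lambda>t. \<phi> t * w t ^ (n - 1)) has_real_derivative 0) (at t)" for t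
  proof -
    have "((\<lambda>t. \<phi> t * w t ^ (n - 1)) has_real_derivative
        \<phi>1 t * w t ^ (n - 1) + (real n - 1) * w t ^ (n - 2) * w1 t * \<phi> t) (at t)"
      by (rule DERIV_mult[OF \<phi>1 wp])
    also have "\<phi>1 t = - ((real n - 1) * \<phi> t * w1 t / w t)" using ode1[of t] by simp
    also have "\<dots> * w t ^ (n - 1) + (real n - 1) * w t ^ (n - 2) * w1 t * \<phi> t = 0"
      unfolding pw using w0[of t] by (simp add: field_simps)
    finally show ?thesis .
  qed
  then have "\<phi> t * w t ^ (n - 1) = \<phi> 0 * w 0 ^ (n - 1)" for t
    by (intro DERIV_isconst_all[of "\<lambda>t. \<phi> t * w t ^ (n - 1)"]) blast
  then obtain C where C: "\<And>t. \<phi> t * w t ^ (n - 1) = C" by blast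
  then have \<phi>: "\<phi> t = C / w t ^ (n - 1)" for t using w0[of t] by (simp add: field_simps)
  define B where "B = real n * C / ((real n - 1) * (real n - 2))"
  have "((\<lambda>t. w1 t / w t - B / w t ^ (n - 1)) has_real_derivative 0) (at t)" for t
  proof -
    have "((\<lambda>t. w1 t / w t - B / w t ^ (n - 1)) has_real_derivative
        (w2 t / w t - (w1 t / w t)\<^sup>2) + B * ((real n - 1) * w t ^ (n - 2) * w1 t) / (w t ^ (n - 1))\<^sup>2) (at t)"
      by (rule DERIV_cong[OF DERIV_diff[OF DERIV_divide[OF w2 w1 w0] DERIV_divide[OF DERIV_const wp]]])
         (use w0[of t] in \<open>simp_all add: field_simps power2_eq_square\<close>)
    also have "w2 t / w t - (w1 t / w t)\<^sup>2 = - (real n * C / w t ^ (n - 1) * (w1 t / w t)) / (real n - 2)"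
    proof -
      have eq: "(real n - 2) * (w2 t / w t - (w1 t / w t)\<^sup>2) = - (real n * C / w t ^ (n - 1) * (w1 t / w t))"
        using ode2[of t] unfolding \<phi>[of t] by simp
      have "real n - 2 \<noteq> 0" using n by simp
      then show ?thesis by (rule eq_divide_imp) (rule trans[OF mult.commute eq])
    qed
    also have "\<dots> + B * ((real n - 1) * w t ^ (n - 2) * w1 t) / (w t ^ (n - 1))\<^sup>2 = 0"
    proof -
      \<comment> \<open>Read a = n-1, b = n-2, q = w^(n-2) and N = n: the value of \<open>B\<close>
        is the one for which the two terms cancel.\<close>
      have "- (N * C / (w t * q) * (w1 t / w t)) / b + N * C / (a * b) * (a * q * w1 t) / (w t * q)\<^sup>2 = 0"
        if "a \<noteq> 0" "b \<noteq> 0" "q \<noteq> 0" for a b q N :: real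
        using that w0[of t] by (simp add: field_simps power2_eq_square)
      then show ?thesis unfolding pw B_def using n w0[of t] by auto
    qed
    finally show ?thesis .
  qed
  then have "w1 t / w t - B / w t ^ (n - 1) = w1 0 / w 0 - B / w 0 ^ (n - 1)" for t
    by (intro DERIV_isconst_all[of "\<lambda>t. w1 t / w t - B / w t ^ (n - 1)"]) blast
  then obtain D where D: "\<And>t. w1 t / w t - B / w t ^ (n - 1) = D" by blast
  have "w1 t = D * w t + B * w t / w t ^ (n - 1)" for t
    using D[of t] w0[of t] by (simp add: field_simps)
  with B_def \<phi> show thesis by (rule that)
qed

text \<open>\<open>y + B / D\<close> solves the homogeneous equation, so its product with the
  inverse exponential is constant.\<close>

lemma linear_ode_solution:
  fixes y :: "real \<Rightarrow> real"
  assumes "\<And>t. (y has_real_derivative k * (D * y t + B)) (at t)" "D \<noteq> 0"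
  shows "y t = (B / D + y 0) * exp (k * D * t) - B / D"
proof -
  have "((\<lambda>t. (y t + B / D) * exp (- (k * D * t))) has_real_derivative 0) (at t)" for t
    using assms(2) by (auto intro!: derivative_eq_intros assms(1) simp: field_simps)
  then have "(y t + B / D) * exp (- (k * D * t)) = (y 0 + B / D) * exp (- (k * D * 0))"
    by (intro DERIV_isconst_all[of "\<lambda>t. (y t + B / D) * exp (- (k * D * t))"]) blast
  then show ?thesis by (simp add: exp_minus field_simps)
qed

text \<open>Since \<open>k\<close> is nonzero, \<open>exp (k * t)\<close> takes every positive value
  s. Large s forces the sign of \<open>a\<close>, small s that of \<open>b\<close>; the two
  quotients below are such values at which the sum would fail to be positive.\<close>

lemma affine_exp_positive:
  fixes a b k :: real
  assumes "k \<noteq> 0" "\<And>t. a * exp (k * t) + b > 0"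
  shows "a \<ge> 0" "b \<ge> 0"
proof -
  have pos: "a * s + b > 0" if "s > 0" for s
    using assms(2)[of "ln s / k"] assms(1) that by simp
  show "a \<ge> 0"
  proof (rule ccontr)
    assume "\<not> a \<ge> 0"
    then have "(\<bar>b\<bar> + 1) / (- a) > 0" "a * ((\<bar>b\<bar> + 1) / (- a)) = - (\<bar>b\<bar> + 1)"
      by (auto simp: field_simps)
    with pos[of "(\<bar>b\<bar> + 1) / (- a)"] show False by linarith
  qed
  show "b \<ge> 0"
  proof (rule ccontr)
    assume b: "\<not> b \<ge> 0"
    have "- b / (\<bar>a\<bar> + 1) > 0" using b by (intro divide_pos_pos) auto
    moreover have "a * (- b / (\<bar>a\<bar> + 1)) \<le> - b"
    proof -
      have "a * (- b) \<le> (\<bar>a\<bar> + 1) * (- b)" using b by (intro mult_right_mono) auto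
      then show ?thesis by (simp add: field_simps)
    qed
    ultimately show False using pos[of "- b / (\<bar>a\<bar> + 1)"] by linarith
  qed
qed

lemma power_powr_inverse:
  fixes x :: real
  assumes "x > 0" "k > 0"
  shows "(x powr (1 / real k)) ^ k = x" "(x ^ k) powr (1 / real k) = x"
  using assms by (simp_all add: powr_realpow[symmetric] powr_powr)

lemma powr_one_minus:
  fixes x :: real
  assumes "x > 0" "n \<ge> 1"
  shows "x powr (1 - real n) = 1 / x ^ (n - 1)"
proof -
  have "1 - real n = - real (n - 1)" using assms by (simp add: of_nat_diff)
  then have "x powr (1 - real n) = inverse (x powr real (n - 1))" by (simp only: powr_minus)
  then show ?thesis using assms(1) by (simp only: powr_realpow inverse_eq_divide)
qed

text \<open>Converse of \<open>soliton_ode_first_order\<close>. The derivative of w'/w is obtained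
  twice, from the quotient rule and from w'/w = D + B w^(1-n), and comparing the two eliminates
  \<open>w2\<close>.\<close>

lemma first_order_imp_soliton_ode:
  fixes n :: nat and w w1 w2 \<phi> \<phi>1 :: "real \<Rightarrow> real"
  assumes n: "n \<ge> 3"
    and w1: "\<And>t. (w has_real_derivative w1 t) (at t)"
    and w2: "\<And>t. (w1 has_real_derivative w2 t) (at t)"
    and \<phi>1: "\<And>t. (\<phi> has_real_derivative \<phi>1 t) (at t)"
    and pos: "\<And>t. w t > 0"
    and B: "B = real n * C / ((real n - 1) * (real n - 2))"
    and \<phi>: "\<And>t. \<phi> t = C / w t ^ (n - 1)"
    and fo: "\<And>t. w1 t = D * w t + B * w t / w t ^ (n - 1)"
  shows "\<phi>1 t + (real n - 1) * \<phi> t * w1 t / w t = 0"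
    and "(real n - 2) * (w2 t / w t - (w1 t / w t)\<^sup>2) + real n * \<phi> t * (w1 t / w t) = 0"
proof -
  have w0: "w t \<noteq> 0" for t using pos[of t] by simp
  have q0: "w t ^ (n - 2) \<noteq> 0" using w0 by simp
  note wp = has_derivative_power_pred[OF n w1] and pw = power_pred[OF n]
  have quot: "((\<lambda>t. c / w t ^ (n - 1)) has_real_derivative
      - (c * ((real n - 1) * w t ^ (n - 2) * w1 t)) / (w t ^ (n - 1))\<^sup>2) (at t)" for c t
    by (rule DERIV_cong[OF DERIV_divide[OF DERIV_const wp]]) (use w0[of t] in \<open>simp_all add: power2_eq_square\<close>)
  have "\<phi> = (\<lambda>t. C / w t ^ (n - 1))" using \<phi> by blast
  then have \<phi>1': "\<phi>1 t = - (C * ((real n - 1) * w t ^ (n - 2) * w1 t)) / (w t ^ (n - 1))\<^sup>2"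
    using DERIV_unique[OF \<phi>1] quot by blast
  show "\<phi>1 t + (real n - 1) * \<phi> t * w1 t / w t = 0"
    unfolding \<phi>1' \<phi> pw using w0[of t] by (simp add: field_simps power2_eq_square)
  have u: "w1 t / w t = D + B / w t ^ (n - 1)" for t using w0[of t] by (simp add: fo field_simps)
  have "((\<lambda>t. w1 t / w t) has_real_derivative w2 t / w t - (w1 t / w t)\<^sup>2) (at t)"
    by (rule DERIV_cong[OF DERIV_divide[OF w2 w1 w0]]) (use w0[of t] in \<open>simp add: field_simps power2_eq_square\<close>)
  moreover have "((\<lambda>t. w1 t / w t) has_real_derivative
      0 + - (B * ((real n - 1) * w t ^ (n - 2) * w1 t)) / (w t ^ (n - 1))\<^sup>2) (at t)"
    unfolding u by (rule DERIV_add[OF DERIV_const quot])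
  ultimately have eq: "w2 t / w t - (w1 t / w t)\<^sup>2
      = - (B * ((real n - 1) * w t ^ (n - 2) * w1 t)) / (w t ^ (n - 1))\<^sup>2"
    using DERIV_unique by fastforce
  have "B * ((real n - 1) * (real n - 2)) = real n * C" using n by (simp add: B)
  then have eq': "real n * C = B * ((real n - 1) * (real n - 2))" by simp
  have val: "(real n - 2) * (- (B * ((real n - 1) * w t ^ (n - 2) * w1 t)) / (w t ^ (n - 1))\<^sup>2)
      = - (real n * C * w t ^ (n - 2) * w1 t / (w t ^ (n - 1))\<^sup>2)"
    unfolding eq' by (simp add: mult_ac)
  show "(real n - 2) * (w2 t / w t - (w1 t / w t)\<^sup>2) + real n * \<phi> t * (w1 t / w t) = 0"
    unfolding eq val unfolding \<phi> pw using w0[of t] by (simp add: field_simps power2_eq_square)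
qed

text \<open>The condition on \<open>E\<close> says K > 0, so y = w^(n-1) stays above -B/D > 0; this
  gives the lower bound \<open>m\<close>. As D is nonzero, K > 0 also makes y non-constant.\<close>

lemma explicit_solution_first_order:
  assumes n: "n \<ge> 3"
    and w1: "\<And>t. (w has_real_derivative w1 t) (at t)"
    and pos: "\<And>t. w t > 0"
    and adm: "admissible_constants n B C D E"
    and expl: "explicit_solution n B C D E w \<phi>"
  shows "\<phi> t = C / w t ^ (n - 1)"
    and "w1 t = D * w t + B * w t / w t ^ (n - 1)"
    and "\<exists>m>0. \<forall>t. m \<le> w t"
    and "\<not> w constant_on UNIV" "\<not> \<phi> constant_on UNIV"
proof -
  define K where "K = B / D + E ^ (n - 1)"
  define y where "y t = K * exp (real (n - 1) * D * t) - B / D" for t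
  have BC: "B > 0" "C > 0" "D < 0" using adm by (auto simp: admissible_constants_def)
  have K: "K > 0"
  proof -
    have "E ^ (n - 1) > - (B / D)" using adm unfolding admissible_constants_def by blast
    then show ?thesis by (simp add: K_def)
  qed
  have BD: "- (B / D) > 0" using BC by (simp add: divide_pos_neg)
  have ge: "y t \<ge> - (B / D)" for t using K by (simp add: y_def)
  have ypos: "y t > 0" for t using ge[of t] BD by linarith
  have wy: "w t = y t powr (1 / real (n - 1))" for t
    using expl unfolding explicit_solution_def y_def K_def by blast
  have yw: "w t ^ (n - 1) = y t" for t
    unfolding wy using ypos n by (intro power_powr_inverse) auto
  have \<phi>: "\<phi> t = C / w t ^ (n - 1)" for t
  proof -
    have "\<phi> t = C * w t powr (1 - real n)" using expl unfolding explicit_solution_def by blast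
    then show ?thesis using powr_one_minus[OF pos, of n t] n by simp
  qed
  show "\<phi> t = C / w t ^ (n - 1)" by (rule \<phi>)
  have "((\<lambda>t. w t ^ (n - 1)) has_real_derivative (real n - 1) * (D * y t + B)) (at t)"
    unfolding yw using n BC by (auto simp: y_def[abs_def] of_nat_diff field_simps intro!: derivative_eq_intros)
  from DERIV_unique[OF this has_derivative_power_pred[OF n w1]]
  have "(real n - 1) * (w t ^ (n - 2) * w1 t) = (real n - 1) * (D * w t ^ (n - 1) + B)"
    by (simp only: yw mult.assoc)
  then have "w t ^ (n - 2) * w1 t = D * w t ^ (n - 1) + B" using n by simp
  then show "w1 t = D * w t + B * w t / w t ^ (n - 1)"
    unfolding power_pred[OF n] using pos[of t] by (simp add: field_simps)
  show "\<exists>m>0. \<forall>t. m \<le> w t"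
    unfolding wy using ge BD
    by (intro exI[of _ "(- (B / D)) powr (1 / real (n - 1))"]) (auto intro!: powr_mono2)
  have "exp (real (n - 1) * D) \<noteq> 1" using BC n by simp
  then have y01: "y 0 \<noteq> y 1" using K by (simp add: y_def)
  show "\<not> w constant_on UNIV"
    using y01 yw unfolding constant_on_def by (metis UNIV_I)
  show "\<not> \<phi> constant_on UNIV"
  proof
    assume "\<phi> constant_on UNIV"
    then have "\<phi> 0 = \<phi> 1" unfolding constant_on_def by (metis UNIV_I)
    then have "C / y 0 = C / y 1" by (simp only: \<phi> yw)
    then show False using y01 BC ypos[of 0] ypos[of 1] by (simp add: field_simps)
  qed
qed

text \<open>Positivity of \<open>w\<close> on the whole line forces \<open>B\<close> and \<open>D\<close> to have opposite signs; the case \<open>B < 0\<close>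
  is the one with reversed orientation.\<close>

lemma first_order_explicit:
  assumes n: "n \<ge> 3"
    and w1: "\<And>t. (w has_real_derivative w1 t) (at t)"
    and pos: "\<And>t. w t > 0"
    and B: "B = real n * C / ((real n - 1) * (real n - 2))"
    and \<phi>: "\<And>t. \<phi> t = C / w t ^ (n - 1)"
    and fo: "\<And>t. w1 t = D * w t + B * w t / w t ^ (n - 1)"
    and nc: "\<not> w constant_on UNIV" "\<not> \<phi> constant_on UNIV"
  shows "\<exists>B C D E. admissible_constants n B C D E \<and>
    (explicit_solution n B C D E w \<phi> \<or> explicit_solution n B C D E (\<lambda>t. w (- t)) (\<lambda>t. - \<phi> (- t)))"
proof -
  define y where "y t = w t ^ (n - 1)" for t
  have ypos: "y t > 0" for t using pos by (simp add: y_def)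
  have wy: "w t = y t powr (1 / real (n - 1))" for t
    unfolding y_def using pos n by (intro power_powr_inverse(2)[symmetric]) auto
  have C0: "C \<noteq> 0" using nc(2) \<phi> by (auto simp: constant_on_def)
  have nn: "real n > 0" "real n - 1 > 0" "real n - 2 > 0" using n by auto
  have n1: "real (n - 1) = real n - 1" "real (n - 2) = real n - 2" using n by (auto simp: of_nat_diff)
  have B0: "B \<noteq> 0" and sgn: "B > 0 \<longleftrightarrow> C > 0" 
  proof -
    define k where "k = real n / ((real n - 1) * (real n - 2))"
    have "k > 0" "B = k * C" using nn by (simp_all add: k_def B)
    then show "B \<noteq> 0" "B > 0 \<longleftrightarrow> C > 0" using C0 by (auto simp: zero_less_mult_iff)
  qed
  have y': "(y has_real_derivative real (n - 1) * (D * y t + B)) (at t)" for t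
  proof -
    have "(real n - 1) * w t ^ (n - 2) * w1 t = real (n - 1) * (D * y t + B)"
      unfolding fo y_def n1 power_pred[OF n] using pos[of t] by (simp add: field_simps)
    then show ?thesis using has_derivative_power_pred[OF n w1, of t] by (simp add: y_def[abs_def])
  qed
  have D0: "D \<noteq> 0"
  proof
    assume [simp]: "D = 0"
    have "((\<lambda>t. y t - real (n - 1) * B * t) has_real_derivative 0) (at t)" for t
      by (auto intro!: derivative_eq_intros y')
    then have "y t - real (n - 1) * B * t = y 0 - real (n - 1) * B * 0" for t
      by (intro DERIV_isconst_all[of "\<lambda>t. y t - real (n - 1) * B * t"]) blast
    \<comment> \<open>For D = 0 the function y is affine with nonzero slope and vanishes at this
      point, against positivity.\<close>
    from this[of "- y 0 / (real (n - 1) * B)"] have "y (- y 0 / (real (n - 1) * B)) = 0"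
      using B0 nn by (simp add: n1)
    then show False using ypos by (metis less_irrefl)
  qed
  define K where "K = B / D + w 0 ^ (n - 1)"
  have sol: "y t = K * exp (real (n - 1) * D * t) - B / D" for t
    using linear_ode_solution[OF y' D0, of t] by (simp add: K_def y_def)
  have "K * exp (real (n - 1) * D * t) + - (B / D) > 0" for t using ypos[of t] by (simp add: sol)
  from affine_exp_positive[OF _ this] have K: "K \<ge> 0" and BD: "B / D \<le> 0" using D0 n by auto
  \<comment> \<open>K = 0 is the stationary solution, for which \<open>w\<close> is
    constant.\<close>
  have "K \<noteq> 0"
  proof
    assume "K = 0"
    then have "w t = (- (B / D)) powr (1 / real (n - 1))" for t by (simp add: wy sol)
    then show False using nc(1) by (auto simp: constant_on_def)
  qed
  with K have K: "w 0 ^ (n - 1) > - (B / D)" by (simp add: K_def)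
  have wt: "w t = ((B / D + w 0 ^ (n - 1)) * exp (real (n - 1) * D * t) - B / D) powr (1 / real (n - 1))" for t
    unfolding wy[of t] sol by (simp add: K_def)
  have \<phi>t: "\<phi> t = C * w t powr (1 - real n)" for t
    using powr_one_minus[OF pos, of n t] n by (simp add: \<phi>)
  show ?thesis
  proof (cases "B > 0")
    case True
    then have "D < 0" using BD D0 by (metis divide_pos_pos less_le_not_le linorder_neqE)
    then have "admissible_constants n B C D (w 0)"
      using True sgn K B unfolding admissible_constants_def n1 by blast
    moreover have "explicit_solution n B C D (w 0) w \<phi>"
      unfolding explicit_solution_def using wt \<phi>t by blast
    ultimately show ?thesis by blast
  next
    case False
    with B0 have neg: "B < 0" by simp
    have D: "- D < 0" using neg BD D0 by (metis divide_neg_neg less_le_not_le linorder_neqE neg_less_0_iff_less)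
    \<comment> \<open>Reversing t changes the signs of B, C and D together, so B/D and the condition
      on \<open>w 0\<close> stay the same.\<close>
    have "- B > 0" "- C > 0" using neg sgn C0 by auto
    moreover have "- B = real n * - C / ((real n - 1) * (real n - 2))" by (simp add: B)
    moreover have "w 0 ^ (n - 1) > - (- B / - D)" using K by simp
    ultimately have "admissible_constants n (- B) (- C) (- D) (w 0)"
      using D unfolding admissible_constants_def n1 by blast
    moreover have "explicit_solution n (- B) (- C) (- D) (w 0) (\<lambda>t. w (- t)) (\<lambda>t. - \<phi> (- t))"
      unfolding explicit_solution_def
    proof (intro conjI allI)
      fix t
      show "w (- t) = ((- B / - D + w 0 ^ (n - 1)) * exp (real (n - 1) * - D * t) - - B / - D)
          powr (1 / real (n - 1))"
        using wt[of "- t"] by simp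
      show "- \<phi> (- t) = - C * w (- t) powr (1 - real n)"
        using \<phi>t[of "- t"] by simp
    qed simp
    ultimately show ?thesis by blast
  qed
qed

section \<open>The classification\<close>

lemma smooth_on_real_derivative:
  fixes F :: "real \<Rightarrow> real"
  assumes "smooth_on UNIV F"
  shows "(F has_real_derivative deriv F t) (at t)" "smooth_on UNIV (deriv F)"
proof -
  have D: "(F has_real_derivative deriv F t) (at t)" for t
    using smooth_onD_differentiable[OF assms, of t] by (simp add: DERIV_deriv_iff_real_differentiable)
  then have "frechet_derivative F (at t) 1 = deriv F t" for t
    unfolding has_field_derivative_def by (metis frechet_derivative_at mult.right_neutral)
  then show "smooth_on UNIV (deriv F)" using smooth_onD_derivative[OF assms, of 1] by simp
  show "(F has_real_derivative deriv F t) (at t)" by (rule D)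
qed

lemma chart_image_warped: "chart_image (warped_chart w c) = UNIV \<times> chart_image c"
  by (auto simp: chart_image_def image_iff)

lemma chart_inv_warped_fst:
  assumes "x \<in> chart_image c"
  shows "fst (chart_inv (warped_chart w c) (t, x)) = t"
proof -
  have "(t, x) \<in> chart_map (warped_chart w c) ` chart_dom (warped_chart w c)"
    using assms chart_image_warped[of w c] by (auto simp: chart_image_def)
  from f_inv_into_f[OF this] show ?thesis
    unfolding chart_inv_def by (auto split: prod.splits)
qed

text \<open>The scalar curvature is kept as it stands, because for a general fibre it is not yet
  known to depend on t alone.\<close>

lemma warped_soliton_iff:
  fixes A :: "('p::{t2_space, second_countable_topology}, 'e::euclidean_space) rchart set"
  assumes A: "riemannian_manifold A" and n: "DIM('e) = n - 1" "n \<ge> 3"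
    and w1: "\<And>t. (w has_real_derivative w1 t) (at t)"
    and w2: "\<And>t. (w1 has_real_derivative w2 t) (at t)"
    and f1: "\<And>t. (f has_real_derivative f1 t) (at t)"
    and f2: "\<And>t. (f1 has_real_derivative f2 t) (at t)"
    and w_pos: "\<And>t. w t > 0"
  shows "steady_RB_soliton (warped_product w A) (\<lambda>(t, p). f t) \<rho> \<longleftrightarrow>
    (\<forall>c\<in>A. \<forall>x\<in>chart_image c. \<forall>t a v b z.
       ricci (chart_metric c) x v z - (w t * w2 t + (real n - 2) * (w1 t)\<^sup>2) * chart_metric c x v z
         - (real n - 1) * (w2 t / w t) * (a * b)
         + (f2 t * (a * b) + f1 t * w t * w1 t * chart_metric c x v z)
       = \<rho> * scalar_curv (warped_metric w (chart_metric c)) (t, x) * (a * b + (w t)\<^sup>2 * chart_metric c x v z))"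
proof -
  have n1: "real DIM('e) = real n - 1" using n by (simp add: of_nat_diff)
  have ric: "ricci (warped_metric w (chart_metric c)) (t, x) (a, v) (b, z) =
       ricci (chart_metric c) x v z - (w t * w2 t + (real n - 2) * (w1 t)\<^sup>2) * chart_metric c x v z
         - (real n - 1) * (w2 t / w t) * (a * b)"
    and hess: "hessian (warped_metric w (chart_metric c)) ((\<lambda>(t, p). f t) \<circ> chart_inv (warped_chart w c)) (t, x) (a, v) (b, z) =
       f2 t * (a * b) + f1 t * w t * w1 t * chart_metric c x v z"
    if c: "c \<in> A" "x \<in> chart_image c" for c x t a v b z
  proof -
    interpret smooth_metric "chart_image c" "chart_metric c"
      using A c by (intro local_riemannian_imp_smooth_metric) (simp add: riemannian_manifold_def)
    interpret warped_smooth_metric "chart_image c" "chart_metric c" w w1 w2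
      by unfold_locales (fact w1 w2 w_pos)+
    show "ricci (warped_metric w (chart_metric c)) (t, x) (a, v) (b, z) =
       ricci (chart_metric c) x v z - (w t * w2 t + (real n - 2) * (w1 t)\<^sup>2) * chart_metric c x v z
         - (real n - 1) * (w2 t / w t) * (a * b)"
      using ricci_warped[OF c(2), of t a v b z] by (simp add: n1)
    show "hessian (warped_metric w (chart_metric c)) ((\<lambda>(t, p). f t) \<circ> chart_inv (warped_chart w c)) (t, x) (a, v) (b, z) =
       f2 t * (a * b) + f1 t * w t * w1 t * chart_metric c x v z"
      by (rule hessian_warped[OF c(2) f1 f2]) (simp add: chart_inv_warped_fst case_prod_beta)
  qed
  show ?thesis
    unfolding steady_RB_soliton_def gradient_RB_soliton_def warped_product_def
    by (simp add: chart_image_warped ric hess) blast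
qed

text \<open>In fibre dimension at least two the factor \<open>DIM('e) - 1\<close> is nonzero, so one
  nonzero vector at one point determines the constant. \<open>undefined\<close> serves as that
  point; the charts cover the whole type.\<close>

lemma einstein_constant_unique:
  fixes A :: "('p::{t2_space, second_countable_topology}, 'e::euclidean_space) rchart set"
  assumes A: "riemannian_manifold A" and dim: "DIM('e) \<ge> 2" and \<mu>: "einstein A \<mu>"
  shows "einstein_constant A = \<mu>"
  unfolding einstein_constant_def
proof (rule the_equality)
  fix \<nu> assume \<nu>: "einstein A \<nu>"
  define c where "c = chart_at A undefined"
  define x where "x = chart_map c undefined"
  have c: "c \<in> A" "x \<in> chart_image c"
    using chart_at_in[OF A, of undefined] by (auto simp: c_def x_def chart_image_def)
  interpret smooth_metric "chart_image c" "chart_metric c"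
    using A c by (intro local_riemannian_imp_smooth_metric) (simp add: riemannian_manifold_def)
  obtain v :: 'e where "v \<in> Basis" using nonempty_Basis by blast
  then have "chart_metric c x v v > 0" using pos[OF c(2)] nonzero_Basis by blast
  moreover have "(real DIM('e) - 1) * \<nu> * chart_metric c x v v = (real DIM('e) - 1) * \<mu> * chart_metric c x v v"
    using \<mu> \<nu> c unfolding einstein_def by metis
  ultimately show "\<nu> = \<mu>" using dim by simp
qed (rule \<mu>)

theorem theorem4p3:
  fixes Mstar :: "('p::{t2_space, second_countable_topology}, 'e::euclidean_space) rchart set"
    and h f :: "real \<Rightarrow> real"
    and n :: nat
  assumes "n \<ge> 3"
    and "DIM('e) = n - 1"
    and "riemannian_manifold Mstar"
    and "smooth_on UNIV h"
    and "smooth_on UNIV f"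
    and "\<forall>t. deriv h t > 0"
    and "n = 3 \<longrightarrow> constant_curvature Mstar (einstein_constant Mstar)"
  shows "(riem_complete (warped_product (deriv h) Mstar) \<and>
          steady_RB_soliton (warped_product (deriv h) Mstar) (\<lambda>(t, p). f t) (1 / real n) \<and>
          einstein_constant Mstar = 0 \<and>
          \<not> deriv h constant_on UNIV \<and> \<not> deriv f constant_on UNIV)
     \<longleftrightarrow>
         (riem_complete Mstar \<and> ricci_flat Mstar \<and>
          (\<exists>B C D E. admissible_constants n B C D E \<and>
             (explicit_solution n B C D E (deriv h) (deriv f) \<or>
              explicit_solution n B C D E (\<lambda>t. deriv h (- t)) (\<lambda>t. - deriv f (- t)))))"
    (is "?L \<longleftrightarrow> ?R")
proof -
  define w where "w = deriv h"
  define w1 where "w1 = deriv w"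
  define w2 where "w2 = deriv w1"
  define \<phi> where "\<phi> = deriv f"
  define \<phi>1 where "\<phi>1 = deriv \<phi>"
  note n = assms(1) and A = assms(3)
  have sm: "smooth_on UNIV w" "smooth_on UNIV w1" "smooth_on UNIV \<phi>"
    unfolding w1_def \<phi>_def w_def using assms(4,5) by (auto intro: smooth_on_real_derivative(2))
  have w1: "(w has_real_derivative w1 t) (at t)" and w2: "(w1 has_real_derivative w2 t) (at t)"
    and f1: "(f has_real_derivative \<phi> t) (at t)" and \<phi>1: "(\<phi> has_real_derivative \<phi>1 t) (at t)" for t
    using smooth_on_real_derivative(1)[OF sm(1), of t] smooth_on_real_derivative(1)[OF sm(2), of t]
      smooth_on_real_derivative(1)[OF sm(3), of t] smooth_on_real_derivative(1)[OF assms(5), of t]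
    by (simp_all add: w1_def w2_def \<phi>_def \<phi>1_def)
  have w_pos: "w t > 0" for t using assms(6) by (simp add: w_def)
  have w0: "w t \<noteq> 0" for t using w_pos[of t] by simp
  have w_cont: "continuous_on UNIV w" using w1 DERIV_continuous_on by blast
  have dim: "DIM('e) \<ge> 2" and n1: "real DIM('e) = real n - 1" using assms(1,2) by (simp_all add: of_nat_diff)
  note soliton_iff = warped_soliton_iff[OF A assms(2) n w1 w2 f1 \<phi>1 w_pos]
  have metric: "warped_smooth_metric (chart_image c) (chart_metric c) w w1 w2" if "c \<in> Mstar" for c
  proof -
    interpret smooth_metric "chart_image c" "chart_metric c"
      using A that by (intro local_riemannian_imp_smooth_metric) (simp add: riemannian_manifold_def)
    show ?thesis by unfold_locales (fact w1 w2 w_pos)+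
  qed
  \<comment> \<open>The eigenvalues of the Ricci tensor along the line and along the fibre when the
    fibre is Ricci flat.\<close>
  define \<alpha> where "\<alpha> t = - ((real n - 1) * (w2 t / w t))" for t
  define \<beta> where "\<beta> t = - (w2 t / w t + (real n - 2) * (w1 t / w t)\<^sup>2)" for t
  have \<beta>: "\<beta> t * (w t)\<^sup>2 = - (w t * w2 t + (real n - 2) * (w1 t)\<^sup>2)" for t
    using w0[of t] by (simp add: \<beta>_def field_simps power2_eq_square)
  have scal: "scalar_curv (warped_metric w (chart_metric c)) (t, x) = \<alpha> t + (real n - 1) * \<beta> t"
    if flat: "ricci_flat Mstar" and c: "c \<in> Mstar" "x \<in> chart_image c" for c x t
  proof -
    interpret warped_smooth_metric "chart_image c" "chart_metric c" w w1 w2 by (rule metric[OF c(1)])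
    have "ricci (warped_metric w (chart_metric c)) (t, x) (a, v) (b, z)
        = \<alpha> t * (a * b) + \<beta> t * ((w t)\<^sup>2 * chart_metric c x v z)" for a v b z
    proof -
      have "ricci (chart_metric c) x v z = 0" using flat c by (simp add: ricci_flat_def)
      then show ?thesis
        unfolding ricci_warped[OF c(2)] mult.assoc[of "\<beta> t", symmetric] \<beta> n1
        by (simp add: \<alpha>_def algebra_simps diff_divide_distrib)
    qed
    from scalar_curv_warped[OF c(2) this] show ?thesis by (simp add: n1)
  qed
  have einstein_flat: "ricci_flat Mstar \<longleftrightarrow> einstein Mstar 0"
    by (simp add: ricci_flat_def einstein_def)
  \<comment> \<open>The right side says that Ric + Hess f has the eigenvalue S/n in both directions.
    Since S/n = \<beta> + (\<alpha> - \<beta>)/n, the fibre direction is the second equation, and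
    inserting it into the line direction gives the first.\<close>
  have ode_split: "\<phi>1 t + (real n - 1) * \<phi> t * w1 t / w t = 0 \<and>
      (real n - 2) * (w2 t / w t - (w1 t / w t)\<^sup>2) + real n * \<phi> t * (w1 t / w t) = 0 \<longleftrightarrow>
      \<alpha> t + \<phi>1 t = (\<alpha> t + (real n - 1) * \<beta> t) / real n \<and>
      \<beta> t + \<phi> t * (w1 t / w t) = (\<alpha> t + (real n - 1) * \<beta> t) / real n" for t
  proof -
    define q where "q = \<phi> t * (w1 t / w t)"
    have ab: "\<alpha> t - \<beta> t = - (real n - 2) * (w2 t / w t - (w1 t / w t)\<^sup>2)"
      by (simp add: \<alpha>_def \<beta>_def algebra_simps diff_divide_distrib)
    have "real n > 0" using n by simp
    then have avg: "(\<alpha> t + (real n - 1) * \<beta> t) / real n = \<beta> t + (\<alpha> t - \<beta> t) / real n"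
      by (simp add: field_simps)
    have div: "y / real n = q \<longleftrightarrow> y = real n * q" for y using n by (auto simp: field_simps)
    have "\<phi>1 t + (real n - 1) * q = 0 \<and> real n * q - (\<alpha> t - \<beta> t) = 0 \<longleftrightarrow>
      \<alpha> t + \<phi>1 t = \<beta> t + (\<alpha> t - \<beta> t) / real n \<and> \<beta> t + q = \<beta> t + (\<alpha> t - \<beta> t) / real n"
      using div[of "\<alpha> t - \<beta> t"] by (auto simp: algebra_simps)
    moreover have "\<phi>1 t + (real n - 1) * \<phi> t * w1 t / w t = \<phi>1 t + (real n - 1) * q"
      by (simp add: q_def mult.assoc)
    moreover have "(real n - 2) * (w2 t / w t - (w1 t / w t)\<^sup>2) + real n * \<phi> t * (w1 t / w t)
        = real n * q - (\<alpha> t - \<beta> t)"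
      by (simp only: ab q_def mult_minus_left diff_minus_eq_add add.commute mult.assoc)
    ultimately show ?thesis by (simp only: avg q_def[symmetric])
  qed
  show ?thesis
  proof
    assume L: ?L
    have complete: "riem_complete Mstar"
      using riem_complete_fibre[OF A w_cont w_pos] L by (simp add: w_def)
    have soliton: "ricci (chart_metric c) x v z - (w t * w2 t + (real n - 2) * (w1 t)\<^sup>2) * chart_metric c x v z
         - (real n - 1) * (w2 t / w t) * (a * b)
         + (\<phi>1 t * (a * b) + \<phi> t * w t * w1 t * chart_metric c x v z)
       = (1 / real n) * scalar_curv (warped_metric w (chart_metric c)) (t, x) * (a * b + (w t)\<^sup>2 * chart_metric c x v z)"
      if "c \<in> Mstar" "x \<in> chart_image c" for c x t a v b z
      using L that unfolding w_def[symmetric] soliton_iff by blast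
    \<comment> \<open>The slice t = 0 suffices to find the Ricci tensor of the fibre:
      \<open>\<kappa>\<close> is S/n there, read off the dt^2 component, and \<open>\<mu>\<close> is
      the factor that the fibre component then forces, the same at all points.\<close>
    define \<kappa> where "\<kappa> = \<alpha> 0 + \<phi>1 0"
    define \<mu> where "\<mu> = \<kappa> * (w 0)\<^sup>2 - \<phi> 0 * w 0 * w1 0 - \<beta> 0 * (w 0)\<^sup>2"
    have ric: "ricci (chart_metric c) x v z = \<mu> * chart_metric c x v z"
      if c: "c \<in> Mstar" "x \<in> chart_image c" for c x v z
    proof -
      interpret warped_smooth_metric "chart_image c" "chart_metric c" w w1 w2 by (rule metric[OF c(1)])
      define S where "S = (1 / real n) * scalar_curv (warped_metric w (chart_metric c)) (0, x)"
      have zero: "chart_metric c x 0 u = 0" for u by (rule bilinear_lzero[OF bil[OF c(2)]])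
      have r: "ricci (chart_metric c) x v z = (S * (w 0)\<^sup>2 - \<phi> 0 * w 0 * w1 0 - \<beta> 0 * (w 0)\<^sup>2) * chart_metric c x v z" for v z
        using soliton[OF c, of v z 0 0 0] by (simp add: S_def \<beta> algebra_simps)
      \<comment> \<open>With zero fibre vectors only the dt^2 part remains; \<open>r\<close> at zero
        vectors shows that \<open>ricci\<close> vanishes there.\<close>
      have "S = \<kappa>" using soliton[OF c, of 0 0 0 1 1] r[of 0 0] by (simp add: S_def \<kappa>_def \<alpha>_def zero)
      then show ?thesis using r by (simp add: \<mu>_def)
    qed
    \<comment> \<open>The normalized constant carries the factor fibre dimension minus one, which is
      n-2.\<close>
    have "einstein Mstar (\<mu> / (real n - 2))" using ric n by (simp add: einstein_def n1)
    moreover from einstein_constant_unique[OF A dim this] L have "\<mu> / (real n - 2) = 0" by simp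
    ultimately have flat: "ricci_flat Mstar" by (simp add: einstein_flat)
    have ode: "\<phi>1 t + (real n - 1) * \<phi> t * w1 t / w t = 0 \<and>
      (real n - 2) * (w2 t / w t - (w1 t / w t)\<^sup>2) + real n * \<phi> t * (w1 t / w t) = 0" for t
    proof -
      define c where "c = chart_at Mstar undefined"
      define x where "x = chart_map c undefined"
      have c: "c \<in> Mstar" "x \<in> chart_image c"
        using chart_at_in[OF A, of undefined] by (auto simp: c_def x_def chart_image_def)
      interpret warped_smooth_metric "chart_image c" "chart_metric c" w w1 w2 by (rule metric[OF c(1)])
      have zero: "chart_metric c x 0 u = 0" for u by (rule bilinear_lzero[OF bil[OF c(2)]])
      have r0: "ricci (chart_metric c) x v z = 0" for v z using flat c by (simp add: ricci_flat_def)
      define S where "S = (\<alpha> t + (real n - 1) * \<beta> t) / real n"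
      have sc: "(1 / real n) * scalar_curv (warped_metric w (chart_metric c)) (t, x) = S"
        by (simp add: scal[OF flat c] S_def)
      have 1: "\<alpha> t + \<phi>1 t = S" using soliton[OF c, of 0 0 t 1 1] unfolding sc r0 by (simp add: zero \<alpha>_def)
      obtain v :: 'e where "v \<in> Basis" using nonempty_Basis by blast
      then have g: "chart_metric c x v v \<noteq> 0" using pos[OF c(2)] nonzero_Basis by (metis less_irrefl)
      have "(\<beta> t * (w t)\<^sup>2 + \<phi> t * w t * w1 t) * chart_metric c x v v = S * (w t)\<^sup>2 * chart_metric c x v v"
        using soliton[OF c, of v v t 0 0] unfolding sc r0 by (simp add: \<beta> algebra_simps)
      then have "\<beta> t * (w t)\<^sup>2 + \<phi> t * w t * w1 t = S * (w t)\<^sup>2" using g by simp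
      moreover have "(w t)\<^sup>2 * (\<beta> t + \<phi> t * (w1 t / w t)) = \<beta> t * (w t)\<^sup>2 + \<phi> t * w t * w1 t"
        using w0[of t] by (simp add: field_simps power2_eq_square)
      ultimately have 2: "\<beta> t + \<phi> t * (w1 t / w t) = S" using w0[of t] by simp
      show ?thesis using 1 2 unfolding ode_split S_def by blast
    qed
    obtain B C D where "B = real n * C / ((real n - 1) * (real n - 2))"
      "\<And>t. \<phi> t = C / w t ^ (n - 1)" "\<And>t. w1 t = D * w t + B * w t / w t ^ (n - 1)"
      using soliton_ode_first_order[OF n w1 w2 \<phi>1 w_pos] ode by metis
    from first_order_explicit[OF n w1 w_pos this] L complete flat show ?R
      by (simp add: w_def \<phi>_def)
  next
    assume R: ?R
    then have flat: "ricci_flat Mstar" and complete: "riem_complete Mstar" by auto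
    obtain B C D E where adm: "admissible_constants n B C D E" and
      expl: "explicit_solution n B C D E w \<phi> \<or> explicit_solution n B C D E (\<lambda>t. w (- t)) (\<lambda>t. - \<phi> (- t))"
      using R by (auto simp: w_def \<phi>_def)
    have Beq: "B = real n * C / ((real n - 1) * (real n - 2))"
      using adm n unfolding admissible_constants_def by (simp add: of_nat_diff)
    \<comment> \<open>These relations do not fix the signs of the constants, so both orientations
      are brought to one statement; the reversed one is evaluated at -t and negates
      \<open>B\<close>, \<open>C\<close> and \<open>D\<close>.\<close>
    have "\<exists>B C D. B = real n * C / ((real n - 1) * (real n - 2)) \<and>
        (\<forall>t. \<phi> t = C / w t ^ (n - 1)) \<and> (\<forall>t. w1 t = D * w t + B * w t / w t ^ (n - 1)) \<and>
        (\<exists>m>0. \<forall>t. m \<le> w t) \<and> \<not> w constant_on UNIV \<and> \<not> \<phi> constant_on UNIV"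
      using expl
    proof
      assume e: "explicit_solution n B C D E w \<phi>"
      note sol = explicit_solution_first_order[OF n w1 w_pos adm e]
      show ?thesis using Beq sol by blast
    next
      assume e: "explicit_solution n B C D E (\<lambda>t. w (- t)) (\<lambda>t. - \<phi> (- t))"
      have d: "((\<lambda>t. w (- t)) has_real_derivative - w1 (- t)) (at t)" for t
        using DERIV_chain2[OF w1 DERIV_minus[OF DERIV_ident], of t] by simp
      note sol = explicit_solution_first_order[OF n d w_pos adm e]
      have "\<phi> t = - C / w t ^ (n - 1)" and "w1 t = - D * w t + - B * w t / w t ^ (n - 1)" for t
        using sol(1)[of "- t"] sol(2)[of "- t"] by simp_all
      moreover have "- B = real n * - C / ((real n - 1) * (real n - 2))" using Beq by simp
      moreover have "\<exists>m>0. \<forall>t. m \<le> w t" using sol(3) by (metis minus_minus)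
      moreover have "\<not> w constant_on UNIV" "\<not> \<phi> constant_on UNIV"
        using sol(4,5) unfolding constant_on_def by (blast, metis UNIV_I)
      ultimately show ?thesis by blast
    qed
    then obtain B C D m where B: "B = real n * C / ((real n - 1) * (real n - 2))"
      and \<phi>: "\<And>t. \<phi> t = C / w t ^ (n - 1)" and fo: "\<And>t. w1 t = D * w t + B * w t / w t ^ (n - 1)"
      and m: "m > 0" "\<And>t. m \<le> w t" and nc: "\<not> w constant_on UNIV" "\<not> \<phi> constant_on UNIV"
      by blast
    note ode = first_order_imp_soliton_ode[OF n w1 w2 \<phi>1 w_pos B \<phi> fo]
    have "steady_RB_soliton (warped_product w Mstar) (\<lambda>(t, p). f t) (1 / real n)"
      unfolding soliton_iff
    proof (intro ballI allI)
      fix c x t a v b z assume c: "c \<in> Mstar" "x \<in> chart_image c"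
      define S where "S = (\<alpha> t + (real n - 1) * \<beta> t) / real n"
      have "\<alpha> t + \<phi>1 t = S" and 2: "\<beta> t + \<phi> t * (w1 t / w t) = S"
        using ode_split[of t] ode[of t] unfolding S_def by blast+
      moreover have "\<beta> t * (w t)\<^sup>2 + \<phi> t * w t * w1 t = S * (w t)\<^sup>2"
        using w0[of t] unfolding 2[symmetric] by (simp add: field_simps power2_eq_square)
      ultimately have main: "(\<alpha> t + \<phi>1 t) * (a * b) + (\<beta> t * (w t)\<^sup>2 + \<phi> t * w t * w1 t) * chart_metric c x v z
          = S * (a * b + (w t)\<^sup>2 * chart_metric c x v z)"
        by (simp add: algebra_simps)
      have "ricci (chart_metric c) x v z = 0" using flat c by (simp add: ricci_flat_def)
      then have "ricci (chart_metric c) x v z - (w t * w2 t + (real n - 2) * (w1 t)\<^sup>2) * chart_metric c x v z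
         - (real n - 1) * (w2 t / w t) * (a * b)
         + (\<phi>1 t * (a * b) + \<phi> t * w t * w1 t * chart_metric c x v z)
       = (\<alpha> t + \<phi>1 t) * (a * b) + (\<beta> t * (w t)\<^sup>2 + \<phi> t * w t * w1 t) * chart_metric c x v z"
        unfolding \<beta> by (simp add: \<alpha>_def algebra_simps)
      moreover have "(1 / real n) * scalar_curv (warped_metric w (chart_metric c)) (t, x) = S"
        by (simp add: scal[OF flat c] S_def)
      ultimately show "ricci (chart_metric c) x v z - (w t * w2 t + (real n - 2) * (w1 t)\<^sup>2) * chart_metric c x v z
         - (real n - 1) * (w2 t / w t) * (a * b)
         + (\<phi>1 t * (a * b) + \<phi> t * w t * w1 t * chart_metric c x v z)
       = (1 / real n) * scalar_curv (warped_metric w (chart_metric c)) (t, x) * (a * b + (w t)\<^sup>2 * chart_metric c x v z)"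
        using main by (simp only:)
    qed
    moreover have "riem_complete (warped_product w Mstar)"
      by (rule riem_complete_warped_product[OF A w_cont m complete])
    moreover have "einstein_constant Mstar = 0"
      using einstein_constant_unique[OF A dim] flat by (simp add: einstein_flat)
    ultimately show ?L using nc by (simp add: w_def \<phi>_def)
  qed
qed

end
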